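(* Let $W$ be a primitive $\omega$-Stone space. Then $\mathrm{id}(\mathscr{X}(W))$ is the orbit diagram $\mathscr{O}(W)$ of $W$. Moreover, $\mathscr{O}(W)$ regularly consolidates $\mathrm{id}(\mathscr{Y})$ for every trim partition $\mathscr{Y}$ of $W$.
   Context: Maps are written on the right. A PO system is a set $P$ with an antisymmetric transitive relation $<$ (possibly $p<p$ for some $p$); $p\leqslant q$ means $p<q$ or $p=q$; $P^{d}=\{p\in P: p\nless p\}$; $p_{\uparrow}=\{q\in P: q\geqslant p\}$, $p_{\downarrow}=\{q\in P:q\leqslant p\}$. An ideal of $P$ is a non-empty lower subset $J$ such that any $x,y\in J$ have a common upper bound in $J$. The ideal completion $\mathrm{id}(P)$ is the set of ideals of $P$ ordered by inclusion, made into a PO system with $\mathrm{id}(P)^d=\{p_\downarrow\mid p\in P^d\}$ (so $J<K$ iff $J\subsetneqq K$, or $J=K\notin\mathrm{id}(P)^d$). A Stone space $W$ is a locally compact Hausdorff space with a base of compact open sets (the Stone space of a Boolean ring, possibly without $1$); it is an $\omega$-Stone space if $R=\mathrm{Co}(W)$, the Boolean ring of compact open subsets, is countable. For $A\in R$ let $(A)=\{C\in R: C\subseteq A\}$, with isomorphism class $[A]$; $A\neq\emptyset$ is pseudo-indecomposable (PI) if for all $B\in R$ with $B\subseteq A$, $(B)\cong(A)$ or $(A-B)\cong(A)$. $W$ is primitive if every element of $R$ is the disjoint union of finitely many PI elements. $\mathscr{X}=\{X_p\mid p\in P\}^{*}$ denotes a family of pairwise disjoint non-empty subsets $X_p$ of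 $W$ together with the remaining set $W-X$ (possibly empty), where $X=\bigcup_p X_p$; it is complete if $X=W$. With $S'$ the set of limit points of $S$, it is a $P$-partition if $X_p'\cap X=\bigcup_{q<p}X_q$ for all $p\in P$. For $Y\subseteq W$, $T_{\mathscr{X}}(Y)=\{p: Y\cap X_p\neq\emptyset\}$. A compact open $A$ is $p$-trim, written $t(A)=p$, if $T_{\mathscr{X}}(A)=p_{\uparrow}$ and, if $p\in P^d$, also $|A\cap X_p|=1$; $\mathrm{Trim}_p(\mathscr{X})$ is the set of $p$-trim sets; a set is trim if it is $p$-trim for some $p$; $\widehat{P}$ is the set of $p$ for which there is a $p$-trim set. For $w\in W$, $I_w=\{t(A)\mid A\text{ trim},\,w\in A\}$. A trim $P$-partition is a $P$-partition such that: (T1) every element of $W$ has a neighbourhood base of trim sets; (T2) for each $p\in\widehat P$, every element of $W$ with a neighbourhood base of $p$-trim sets lies in $X_p$; (T3) every point of each $X_p$ has a $p$-trim neighbourhood. For a trim $P$-partition $\mathscr{Y}$ of an $\omega$-Stone space, $\mathrm{id}(\mathscr{Y})=\{Y(J)\mid J\in\mathrm{id}(P)\}$, where $Y(J)=\{w\in W\mid I_w=J\}$. For primitive $W$: $\mathscr{S}(W)=\{[A]\mid A\in R\text{ is PI}\}$ is the PO system with $[A]<[B]$ iff $(A)\times(B)\cong(A)$; the canonical partition is $\mathscr{X}(W)=\{X_p\mid p\in\mathscr{S}(W)\}^*$, where $X_p$ is the set of points with a neighbourhood base of compact open sets $A$ with $[A]=p$ (this is a trim $\mathscr{S}(W)$-partition).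 The orbit diagram $\mathscr{O}(W)=\{[w]\mid w\in W\}$ is the set of orbits $[w]$ of points under homeomorphisms $W\to W$, with the relation $[w]<[x]$ iff some point in $[w]$ is a limit of distinct points in $[x]$; it is viewed as a complete partition of $W$ indexed by itself. The first assertion means that the elements of $\mathrm{id}(\mathscr{X}(W))$ are exactly the orbits and that the order relation on $\mathrm{id}(\mathscr{S}(W))$ matches that on $\mathscr{O}(W)$. For a $P$-partition $\mathscr{Z}=\{Z_p\}^*$ and $Q$-partition $\mathscr{Y}=\{Y_q\}^*$ satisfying T1, $\mathscr{Z}$ regularly consolidates $\mathscr{Y}$ if for some $\alpha\colon Q\to P$ we have $Y_q\subseteq Z_{q\alpha}$ for all $q\in Q$, and $p\in T_{\mathscr{Y}}(A)\alpha$ for all $p\in\widehat P$ and $A\in\mathrm{Trim}_p(\mathscr{Z})$ (the PO systems here need not be countable). *)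

theory Defs
  imports "HOL-Analysis.Analysis" "HOL-Algebra.Chinese_Remainder"
begin

section \<open>PO systems and their ideal completions\<close>

record 'p po_sys =
  po_carrier :: "'p set"
  po_less :: "'p \<Rightarrow> 'p \<Rightarrow> bool"

text \<open>The relation is transitive and antisymmetric, but an element may satisfy \<open>p < p\<close>.\<close>

definition po_system :: "'p po_sys \<Rightarrow> bool" where
  "po_system P \<longleftrightarrow>
     antisymp_on (po_carrier P) (po_less P) \<and> transp_on (po_carrier P) (po_less P)"

definition po_leq :: "'p po_sys \<Rightarrow> 'p \<Rightarrow> 'p \<Rightarrow> bool" where
  "po_leq P p q \<longleftrightarrow> po_less P p q \<or> p = q"

definition po_irrefl :: "'p po_sys \<Rightarrow> 'p set" where  \<comment> \<open>\<open>P\<^sup>d\<close>\<close>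
  "po_irrefl P = {p \<in> po_carrier P. \<not> po_less P p p}"

definition po_up :: "'p po_sys \<Rightarrow> 'p \<Rightarrow> 'p set" where
  "po_up P p = {q \<in> po_carrier P. po_leq P p q}"

definition po_down :: "'p po_sys \<Rightarrow> 'p \<Rightarrow> 'p set" where
  "po_down P p = {q \<in> po_carrier P. po_leq P q p}"

definition po_ideal :: "'p po_sys \<Rightarrow> 'p set \<Rightarrow> bool" where
  "po_ideal P J \<longleftrightarrow>
     J \<subseteq> po_carrier P \<and> J \<noteq> {} \<and>
     (\<forall>x\<in>J. \<forall>y\<in>po_carrier P. po_leq P y x \<longrightarrow> y \<in> J) \<and>
     (\<forall>x\<in>J. \<forall>y\<in>J. \<exists>z\<in>J. po_leq P x z \<and> po_leq P y z)"

definition id_completion :: "'p po_sys \<Rightarrow> 'p set po_sys" where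
  "id_completion P =
     \<lparr>po_carrier = {J. po_ideal P J},
      po_less = (\<lambda>J K. J \<subset> K \<or> (J = K \<and> J \<notin> po_down P ` po_irrefl P))\<rparr>"

definition po_iso :: "('p \<Rightarrow> 'q) \<Rightarrow> 'p po_sys \<Rightarrow> 'q po_sys \<Rightarrow> bool" where
  "po_iso f P Q \<longleftrightarrow>
     bij_betw f (po_carrier P) (po_carrier Q) \<and>
     (\<forall>p\<in>po_carrier P. \<forall>q\<in>po_carrier P. po_less P p q \<longleftrightarrow> po_less Q (f p) (f q))"


section \<open>Stone spaces and pseudo-indecomposable sets\<close>

definition Co :: "'w topology \<Rightarrow> 'w set set" where
  "Co W = {A. openin W A \<and> compactin W A}"

definition stone_space :: "'w topology \<Rightarrow> bool" where
  "stone_space W \<longleftrightarrow>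
     locally_compact_space W \<and> Hausdorff_space W \<and>
     openin W = arbitrary union_of (\<lambda>A. A \<in> Co W)"

definition omega_stone_space :: "'w topology \<Rightarrow> bool" where
  "omega_stone_space W \<longleftrightarrow> stone_space W \<and> countable (Co W)"

text \<open>
  The Boolean ring \<open>(A)\<close>, with symmetric difference as addition. Its identity is \<open>A\<close>, so requiring
  isomorphisms to preserve the identity, as \<^const>\<open>ring_iso\<close> does, is no restriction.
\<close>

definition principal_ring :: "'w topology \<Rightarrow> 'w set \<Rightarrow> 'w set ring" where
  "principal_ring W A =
     \<lparr>carrier = {C \<in> Co W. C \<subseteq> A}, mult = (\<inter>), one = A,
      zero = {}, add = (\<lambda>C D. (C - D) \<union> (D - C))\<rparr>"

definition pseudo_indecomposable :: "'w topology \<Rightarrow> 'w set \<Rightarrow> bool" where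
  "pseudo_indecomposable W A \<longleftrightarrow>
     A \<in> Co W \<and> A \<noteq> {} \<and>
     (\<forall>B\<in>Co W. B \<subseteq> A \<longrightarrow>
        principal_ring W B \<simeq> principal_ring W A \<or>
        principal_ring W (A - B) \<simeq> principal_ring W A)"

definition primitive_space :: "'w topology \<Rightarrow> bool" where
  "primitive_space W \<longleftrightarrow>
     stone_space W \<and>
     (\<forall>A\<in>Co W. \<exists>F. finite F \<and> pairwise disjnt F \<and>
        (\<forall>B\<in>F. pseudo_indecomposable W B) \<and> A = \<Union>F)"

text \<open>
  The isomorphism class \<open>[A]\<close> is represented by the set of all compact open subsets of \<open>W\<close> whose
  ring is isomorphic to that of \<open>A\<close>.
\<close>

definition iso_class :: "'w topology \<Rightarrow> 'w set \<Rightarrow> 'w set set" where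
  "iso_class W A = {B \<in> Co W. principal_ring W B \<simeq> principal_ring W A}"

definition PI_system :: "'w topology \<Rightarrow> 'w set set po_sys" where  \<comment> \<open>\<open>\<S>(W)\<close>\<close>
  "PI_system W =
     \<lparr>po_carrier = iso_class W ` {A. pseudo_indecomposable W A},
      po_less = (\<lambda>p q. \<exists>A B. pseudo_indecomposable W A \<and> pseudo_indecomposable W B \<and>
         p = iso_class W A \<and> q = iso_class W B \<and>
         RDirProd (principal_ring W A) (principal_ring W B) \<simeq> principal_ring W A)\<rparr>"


section \<open>Partitions indexed by a PO system\<close>

text \<open>
  A family \<open>{X\<^sub>p | p \<in> P}*\<close> is given by \<open>P\<close> and a function \<open>X\<close> whose values outside the carrier of
  \<open>P\<close> are irrelevant.
\<close>

definition family_union :: "'p po_sys \<Rightarrow> ('p \<Rightarrow> 'w set) \<Rightarrow> 'w set" where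
  "family_union P X = (\<Union>p\<in>po_carrier P. X p)"

definition po_partition :: "'w topology \<Rightarrow> 'p po_sys \<Rightarrow> ('p \<Rightarrow> 'w set) \<Rightarrow> bool" where
  "po_partition W P X \<longleftrightarrow>
     po_system P \<and>
     (\<forall>p\<in>po_carrier P. X p \<noteq> {} \<and> X p \<subseteq> topspace W) \<and>
     disjoint_family_on X (po_carrier P) \<and>
     (\<forall>p\<in>po_carrier P.
        (W derived_set_of X p) \<inter> family_union P X
          = (\<Union>q\<in>{q \<in> po_carrier P. po_less P q p}. X q))"

definition type_set :: "'p po_sys \<Rightarrow> ('p \<Rightarrow> 'w set) \<Rightarrow> 'w set \<Rightarrow> 'p set" where
  "type_set P X Y = {p \<in> po_carrier P. Y \<inter> X p \<noteq> {}}"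

definition Trim :: "'w topology \<Rightarrow> 'p po_sys \<Rightarrow> ('p \<Rightarrow> 'w set) \<Rightarrow> 'p \<Rightarrow> 'w set set" where
  "Trim W P X p =
     {A \<in> Co W. type_set P X A = po_up P p \<and> (p \<in> po_irrefl P \<longrightarrow> card (A \<inter> X p) = 1)}"

definition trim_set :: "'w topology \<Rightarrow> 'p po_sys \<Rightarrow> ('p \<Rightarrow> 'w set) \<Rightarrow> 'w set \<Rightarrow> bool" where
  "trim_set W P X A \<longleftrightarrow> (\<exists>p\<in>po_carrier P. A \<in> Trim W P X p)"

definition trim_types :: "'w topology \<Rightarrow> 'p po_sys \<Rightarrow> ('p \<Rightarrow> 'w set) \<Rightarrow> 'p set" where
  "trim_types W P X = {p \<in> po_carrier P. Trim W P X p \<noteq> {}}"  \<comment> \<open>\<open>P\<close> with a hat\<close>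

text \<open>\<open>I\<^sub>w\<close>; membership of \<open>A\<close> in \<^term>\<open>Trim W P X p\<close> expresses \<open>t(A) = p\<close>.\<close>

definition point_types :: "'w topology \<Rightarrow> 'p po_sys \<Rightarrow> ('p \<Rightarrow> 'w set) \<Rightarrow> 'w \<Rightarrow> 'p set" where
  "point_types W P X w = {p \<in> po_carrier P. \<exists>A\<in>Trim W P X p. w \<in> A}"

definition T1_condition :: "'w topology \<Rightarrow> 'p po_sys \<Rightarrow> ('p \<Rightarrow> 'w set) \<Rightarrow> bool" where
  "T1_condition W P X \<longleftrightarrow>
     (\<forall>w\<in>topspace W. neighbourhood_base_at w (trim_set W P X) W)"

definition T2_condition :: "'w topology \<Rightarrow> 'p po_sys \<Rightarrow> ('p \<Rightarrow> 'w set) \<Rightarrow> bool" where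
  "T2_condition W P X \<longleftrightarrow>
     (\<forall>p\<in>trim_types W P X. \<forall>w\<in>topspace W.
        neighbourhood_base_at w (\<lambda>A. A \<in> Trim W P X p) W \<longrightarrow> w \<in> X p)"

definition T3_condition :: "'w topology \<Rightarrow> 'p po_sys \<Rightarrow> ('p \<Rightarrow> 'w set) \<Rightarrow> bool" where
  "T3_condition W P X \<longleftrightarrow>
     (\<forall>p\<in>po_carrier P. \<forall>w\<in>X p. \<exists>A\<in>Trim W P X p. w \<in> A)"

definition trim_partition :: "'w topology \<Rightarrow> 'p po_sys \<Rightarrow> ('p \<Rightarrow> 'w set) \<Rightarrow> bool" where
  "trim_partition W P X \<longleftrightarrow>
     po_partition W P X \<and> T1_condition W P X \<and> T2_condition W P X \<and> T3_condition W P X"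

text \<open>
  The members \<open>Y(J)\<close> of the family \<open>id(\<Y>)\<close>, which is indexed by \<^term>\<open>id_completion P\<close>.
\<close>

definition id_part :: "'w topology \<Rightarrow> 'p po_sys \<Rightarrow> ('p \<Rightarrow> 'w set) \<Rightarrow> 'p set \<Rightarrow> 'w set" where
  "id_part W P Y J = {w \<in> topspace W. point_types W P Y w = J}"

definition canonical_partition :: "'w topology \<Rightarrow> 'w set set \<Rightarrow> 'w set" where
  "canonical_partition W p =
     {w \<in> topspace W. neighbourhood_base_at w (\<lambda>A. A \<in> Co W \<and> iso_class W A = p) W}"

text \<open>
  Being partitions that satisfy \<open>T1\<close> is part of what it means for one family to regularly
  consolidate another.
\<close>

definition regularly_consolidates ::
  "'w topology \<Rightarrow> 'p po_sys \<Rightarrow> ('p \<Rightarrow> 'w set) \<Rightarrow> 'q po_sys \<Rightarrow> ('q \<Rightarrow> 'w set) \<Rightarrow> bool" where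
  "regularly_consolidates W P Z Q Y \<longleftrightarrow>
     po_partition W P Z \<and> T1_condition W P Z \<and>
     po_partition W Q Y \<and> T1_condition W Q Y \<and>
     (\<exists>\<alpha>. \<alpha> \<in> po_carrier Q \<rightarrow> po_carrier P \<and>
        (\<forall>q\<in>po_carrier Q. Y q \<subseteq> Z (\<alpha> q)) \<and>
        (\<forall>p\<in>trim_types W P Z. \<forall>A\<in>Trim W P Z p. p \<in> \<alpha> ` type_set Q Y A))"


section \<open>The orbit diagram\<close>

definition point_orbit :: "'w topology \<Rightarrow> 'w \<Rightarrow> 'w set" where
  "point_orbit W w = {h w | h. homeomorphic_map W W h}"

text \<open>
  As a partition of \<open>W\<close>, the orbit diagram is indexed by itself, i.e. by the identity function.
\<close>

definition orbit_diagram :: "'w topology \<Rightarrow> 'w set po_sys" where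
  "orbit_diagram W =
     \<lparr>po_carrier = point_orbit W ` topspace W,
      po_less = (\<lambda>p q. \<exists>w\<in>p. w \<in> W derived_set_of q)\<rparr>"

end

theory Submission
  imports Defs
begin

text \<open>
  Let \<open>\<X>\<close> be a trim partition of an \<open>\<omega>\<close>-Stone space, indexed by \<open>P\<close>.  What carries the proof is that
  trim sets of the same type are homeomorphic, by a homeomorphism that may be required to take a given
  point \<open>w\<close> to a given point \<open>x\<close> with \<open>I\<^sub>w = I\<^sub>x\<close> (\<open>Trim_homeomorphic\<close>).  This is a back-and-forth
  argument (\<open>back_and_forth\<close>): if a \<open>p\<close>-trim set is cut in two, one part is again \<open>p\<close>-trim, the other is a
  disjoint union of trim sets of types \<open>q > p\<close>, and every \<open>p\<close>-trim set contains disjoint trim sets of those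
  types whose removal leaves it \<open>p\<close>-trim, because its points of type \<open>p\<close> are limits of points of type
  \<open>q\<close>.  Interchanging disjoint neighbourhoods of \<open>w\<close> and \<open>x\<close> one sees that points with the same ideal
  lie in the same orbit (\<open>same_types_same_orbit\<close>).  Every ideal occurs as \<open>I\<^sub>x\<close> inside any trim set whose
  type belongs to it, since \<open>P\<close> is countable and trim sets whose types are cofinal in the ideal can
  be made to shrink to a point (\<open>ideal_realised\<close>).  From this one reads off the limit points of the
  sets \<open>X(J)\<close>, and that \<open>id(\<X>)\<close> is a partition satisfying T1, indexed by the ideal completion of \<open>P\<close>.

  For a primitive space it remains to see that the canonical partition is trim.  Here the order of
  \<open>\<S>(W)\<close> is first replaced by the relation "\<open>A\<close> contains disjoint copies of \<open>A\<close> and \<open>B\<close>".  By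
  pseudo-indecomposability the two relations can differ only when \<open>[A] = [B]\<close>, and for the new one the
  partition is easily seen to be trim.  If now \<open>A\<close> contains two disjoint copies of itself, then the
  removal of one of them leaves a trim set of the same type, which is homeomorphic to \<open>A\<close> by the
  uniqueness theorem, so that \<open>(A) \<times> (A) \<cong> (A)\<close>.  Thus the two relations agree.  Since the types of
  trim sets of the canonical partition are their isomorphism classes, homeomorphisms of \<open>W\<close> preserve
  the ideals \<open>I\<^sub>w\<close>, and the orbits are precisely the sets \<open>X(J)\<close>.

  For an arbitrary trim partition \<open>\<Y>\<close> of \<open>W\<close>, each \<open>Y(J)\<close> lies in one orbit.  A set that is trim of
  type \<open>p\<close> for the orbit diagram meets \<open>p\<close>, and the ideal of any of its points in \<open>p\<close> witnesses regularity.
\<close>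


section \<open>Compact open sets of an omega-Stone space\<close>

locale omega_stone =
  fixes W :: "'w topology"
  assumes omega: "omega_stone_space W"
begin

lemma stone: "stone_space W" and countable_Co: "countable (Co W)"
  using omega by (auto simp: omega_stone_space_def)

lemma Hausdorff: "Hausdorff_space W"
  using stone by (auto simp: stone_space_def)

lemma Co_openin: "A \<in> Co W \<Longrightarrow> openin W A"
  and Co_compactin: "A \<in> Co W \<Longrightarrow> compactin W A"
  by (auto simp: Co_def)

lemma Co_closedin: "A \<in> Co W \<Longrightarrow> closedin W A"
  using Co_compactin Hausdorff compactin_imp_closedin by blast

lemma Co_subset_topspace: "A \<in> Co W \<Longrightarrow> A \<subseteq> topspace W"
  using Co_openin openin_subset by blast

lemma Co_empty [simp, intro]: "{} \<in> Co W"
  by (simp add: Co_def)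

lemma Co_Un [intro]: "\<lbrakk>A \<in> Co W; B \<in> Co W\<rbrakk> \<Longrightarrow> A \<union> B \<in> Co W"
  by (auto simp: Co_def intro: compactin_Un)

lemma Co_Int [intro]: "\<lbrakk>A \<in> Co W; B \<in> Co W\<rbrakk> \<Longrightarrow> A \<inter> B \<in> Co W"
  using Co_closedin[of B] unfolding Co_def by (blast intro: compact_Int_closedin)

lemma Co_Diff [intro]: "\<lbrakk>A \<in> Co W; B \<in> Co W\<rbrakk> \<Longrightarrow> A - B \<in> Co W"
proof -
  assume A: "A \<in> Co W" and B: "B \<in> Co W"
  have "openin W (A - B)"
    using A B Co_openin Co_closedin by blast
  moreover have "compactin W (A - B)"
  proof -
    have "A - B = A \<inter> (topspace W - B)"
      using Co_subset_topspace[OF A] by blast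
    moreover have "closedin W (topspace W - B)"
      using B Co_openin by blast
    ultimately show ?thesis
      using compact_Int_closedin[OF Co_compactin[OF A]] by simp
  qed
  ultimately show ?thesis by (simp add: Co_def)
qed

lemma Co_base:
  assumes "openin W U" "x \<in> U"
  shows "\<exists>A. A \<in> Co W \<and> x \<in> A \<and> A \<subseteq> U"
proof -
  have "(arbitrary union_of (\<lambda>A. A \<in> Co W)) U"
    using stone assms(1) by (simp add: stone_space_def)
  then obtain \<U> where "\<U> \<subseteq> Co W" "\<Union>\<U> = U"
    by (auto simp: union_of_def arbitrary_def)
  then show ?thesis using assms(2) by blast
qed

lemma Co_remove_point: "A \<in> Co W \<Longrightarrow> openin W (A - {x})"
proof (cases "x \<in> topspace W")
  case True
  assume A: "A \<in> Co W"
  have "closedin W {x}"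
    using Hausdorff True by (simp add: Hausdorff_imp_t1_space closedin_t1_singleton)
  then show ?thesis using Co_openin[OF A] by blast
next
  case False
  assume A: "A \<in> Co W"
  then have "A - {x} = A" using False Co_subset_topspace by blast
  then show ?thesis using Co_openin[OF A] by simp
qed

lemma Co_separate:
  assumes "x \<in> topspace W" "x \<noteq> y"
  obtains A where "A \<in> Co W" "x \<in> A" "y \<notin> A"
proof -
  obtain B where B: "B \<in> Co W" "x \<in> B"
    using Co_base[OF openin_topspace assms(1)] by blast
  obtain A where "A \<in> Co W" "x \<in> A" "A \<subseteq> B - {y}"
    using Co_base[OF Co_remove_point[OF B(1)], of x y] B assms by blast
  then show thesis using that by blast
qed

lemma Co_nest_nonempty:
  fixes A :: "nat \<Rightarrow> 'w set"
  assumes "\<And>n. A n \<in> Co W" "\<And>n. A n \<noteq> {}" "\<And>n. A (Suc n) \<subseteq> A n"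
  obtains x where "\<And>n. x \<in> A n"
proof -
  have "compact_space (subtopology W (A 0))"
    using assms(1) Co_compactin compact_space_subtopology by blast
  moreover have dec: "decseq A" using assms(3) decseq_SucI by blast
  moreover have "closedin (subtopology W (A 0)) (A n)" for n
    using decseqD[OF dec, of 0 n] Co_closedin assms(1) by (auto intro: closedin_subset_topspace)
  ultimately have "(\<Inter>n. A n) \<noteq> {}"
    using assms(2) by (intro compact_space_imp_nest)
  then show thesis using that by blast
qed

text \<open>
  The countably many compact open sets are dealt with one at a time: at stage \<open>n\<close> one passes to a
  subset on one side of the \<open>n\<close>-th of them.  The intersection is non-empty by compactness, and every
  neighbourhood of a point of it contains some member of the sequence.
\<close>

lemma shrinking_sets:
  assumes start: "Q 0 A0" and Co: "\<And>n A. Q n A \<Longrightarrow> A \<in> Co W" and ne: "\<And>n A. Q n A \<Longrightarrow> A \<noteq> {}"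
    and step: "\<And>n A C. \<lbrakk>Q n A; C \<in> Co W\<rbrakk> \<Longrightarrow>
                 \<exists>B\<subseteq>A. Q (Suc n) B \<and> (B \<subseteq> C \<or> B \<inter> C = {})"
  shows "\<exists>x A. (\<forall>n. Q n (A n) \<and> x \<in> A n \<and> A n \<subseteq> A0) \<and>
           (\<forall>U. openin W U \<and> x \<in> U \<longrightarrow> (\<exists>n. A n \<subseteq> U))"
proof -
  define c where "c = from_nat_into (Co W)"
  have c: "range c = Co W"
    unfolding c_def using countable_Co by (intro range_from_nat_into) auto
  define ok where "ok = (\<lambda>n A. Q n A \<and> A \<subseteq> A0)"
  have "\<exists>A. \<forall>n. ok n (A n) \<and> (A (Suc n) \<subseteq> A n \<and> (A (Suc n) \<subseteq> c n \<or> A (Suc n) \<inter> c n = {}))"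
  proof (rule dependent_nat_choice)
    show "\<exists>A. ok 0 A" using start by (auto simp: ok_def)
  next
    fix A n assume "ok n A"
    moreover have "c n \<in> Co W" using c by blast
    ultimately show "\<exists>B. ok (Suc n) B \<and> (B \<subseteq> A \<and> (B \<subseteq> c n \<or> B \<inter> c n = {}))"
      using step[of n A "c n"] unfolding ok_def by blast
  qed
  then obtain A where A: "\<And>n. Q n (A n)" "\<And>n. A n \<subseteq> A0" "\<And>n. A (Suc n) \<subseteq> A n"
    "\<And>n. A (Suc n) \<subseteq> c n \<or> A (Suc n) \<inter> c n = {}"
    unfolding ok_def by blast
  obtain x where x: "\<And>n. x \<in> A n"
    using Co_nest_nonempty[of A] A Co ne by metis
  have "\<exists>n. A n \<subseteq> U" if "openin W U" "x \<in> U" for U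
  proof -
    obtain C where C: "C \<in> Co W" "x \<in> C" "C \<subseteq> U" using Co_base \<open>openin W U\<close> \<open>x \<in> U\<close> by blast
    then obtain n where "C = c n" using c by blast
    then show ?thesis using A(4)[of n] x[of "Suc n"] C by blast
  qed
  then show ?thesis using A(1,2) x by (intro exI[of _ x] exI[of _ A]) simp
qed

section \<open>Back and forth\<close>

text \<open>
  A partition of \<open>A\<close> matched with a partition of \<open>B\<close>, as a set of pairs.  Only points have to determine
  the pair to which they belong, so that pairs of empty sets do no harm.
\<close>

definition splits :: "('w set \<times> 'w set) set \<Rightarrow> 'w set \<Rightarrow> 'w set \<Rightarrow> bool" where
  "splits N A B \<longleftrightarrow>
     (\<forall>z\<in>N. fst z \<subseteq> A \<and> snd z \<subseteq> B) \<and>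
     (\<forall>w\<in>A. \<exists>!z. z \<in> N \<and> w \<in> fst z) \<and> (\<forall>x\<in>B. \<exists>!z. z \<in> N \<and> x \<in> snd z)"

definition decides :: "('w set \<times> 'w set) set \<Rightarrow> 'w set \<Rightarrow> bool" where
  "decides N C \<longleftrightarrow> (\<forall>(A, B)\<in>N. (A \<subseteq> C \<or> A \<inter> C = {}) \<and> (B \<subseteq> C \<or> B \<inter> C = {}))"

lemma decidesD:
  assumes "decides N C" "z \<in> N"
  shows "fst z \<subseteq> C \<or> fst z \<inter> C = {}" and "snd z \<subseteq> C \<or> snd z \<inter> C = {}"
  using assms by (cases z; auto simp: decides_def)+

lemma splits_subset: "\<lbrakk>splits N A B; z \<in> N\<rbrakk> \<Longrightarrow> fst z \<subseteq> A \<and> snd z \<subseteq> B"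
  by (simp add: splits_def)

lemma splits_cover:
  assumes "splits N A B"
  shows "w \<in> A \<Longrightarrow> \<exists>z\<in>N. w \<in> fst z" and "x \<in> B \<Longrightarrow> \<exists>z\<in>N. x \<in> snd z"
  using assms unfolding splits_def by (meson ex1_implies_ex)+

lemma splits_unique_fst: "\<lbrakk>splits N A B; z \<in> N; z' \<in> N; w \<in> fst z; w \<in> fst z'\<rbrakk> \<Longrightarrow> z = z'"
  and splits_unique_snd: "\<lbrakk>splits N A B; z \<in> N; z' \<in> N; x \<in> snd z; x \<in> snd z'\<rbrakk> \<Longrightarrow> z = z'"
  unfolding splits_def by (metis subsetD)+

lemma splits_two:
  assumes "C \<subseteq> A" "D \<subseteq> B"
  shows "splits {(C, D), (A - C, B - D)} A B"
  unfolding splits_def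
proof (intro conjI ballI)
  fix w assume "w \<in> A"
  then show "\<exists>!z. z \<in> {(C, D), (A - C, B - D)} \<and> w \<in> fst z"
    by (intro ex1I[of _ "if w \<in> C then (C, D) else (A - C, B - D)"]) auto
next
  fix x assume "x \<in> B"
  then show "\<exists>!z. z \<in> {(C, D), (A - C, B - D)} \<and> x \<in> snd z"
    by (intro ex1I[of _ "if x \<in> D then (C, D) else (A - C, B - D)"]) auto
qed (use assms in auto)

lemma splits_Union:
  assumes M: "splits M E F" and N: "\<And>z. z \<in> M \<Longrightarrow> splits (N z) (fst z) (snd z)"
  shows "splits (\<Union>z\<in>M. N z) E F"
  unfolding splits_def
proof (intro conjI ballI)
  fix z assume "z \<in> (\<Union>z\<in>M. N z)"
  then obtain y where "y \<in> M" "z \<in> N y" by blast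
  then show "fst z \<subseteq> E" "snd z \<subseteq> F"
    using splits_subset[OF M] splits_subset[OF N] by blast+
next
  fix w assume "w \<in> E"
  then obtain y where y: "y \<in> M" "w \<in> fst y" "\<And>y'. \<lbrakk>y' \<in> M; w \<in> fst y'\<rbrakk> \<Longrightarrow> y' = y"
    using M unfolding splits_def by metis
  then obtain z where z: "z \<in> N y" "w \<in> fst z" "\<And>z'. \<lbrakk>z' \<in> N y; w \<in> fst z'\<rbrakk> \<Longrightarrow> z' = z"
    using N[of y] unfolding splits_def by metis
  show "\<exists>!z. z \<in> (\<Union>z\<in>M. N z) \<and> w \<in> fst z"
  proof (rule ex1I[of _ z])
    show "z \<in> (\<Union>z\<in>M. N z) \<and> w \<in> fst z" using y z by blast
    fix z' assume z': "z' \<in> (\<Union>z\<in>M. N z) \<and> w \<in> fst z'"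
    then obtain y' where y': "y' \<in> M" "z' \<in> N y'" by blast
    then have "fst z' \<subseteq> fst y'" using N[OF y'(1)] unfolding splits_def by simp
    then have "w \<in> fst y'" using z' by blast
    then have "y' = y" using y y' by blast
    then show "z' = z" using z z' y' by blast
  qed
next
  fix w assume "w \<in> F"
  then obtain y where y: "y \<in> M" "w \<in> snd y" "\<And>y'. \<lbrakk>y' \<in> M; w \<in> snd y'\<rbrakk> \<Longrightarrow> y' = y"
    using M unfolding splits_def by metis
  then obtain z where z: "z \<in> N y" "w \<in> snd z" "\<And>z'. \<lbrakk>z' \<in> N y; w \<in> snd z'\<rbrakk> \<Longrightarrow> z' = z"
    using N[of y] unfolding splits_def by metis
  show "\<exists>!z. z \<in> (\<Union>z\<in>M. N z) \<and> w \<in> snd z"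
  proof (rule ex1I[of _ z])
    show "z \<in> (\<Union>z\<in>M. N z) \<and> w \<in> snd z" using y z by blast
    fix z' assume z': "z' \<in> (\<Union>z\<in>M. N z) \<and> w \<in> snd z'"
    then obtain y' where y': "y' \<in> M" "z' \<in> N y'" by blast
    then have "snd z' \<subseteq> snd y'" using N[OF y'(1)] unfolding splits_def by simp
    then have "w \<in> snd y'" using z' by blast
    then have "y' = y" using y y' by blast
    then show "z' = z" using z z' y' by blast
  qed
qed

end

text \<open>
  A Vaught relation: whatever is cut off on one side can be matched on the other.
\<close>

locale zigzag = omega_stone W for W :: "'w topology" +
  fixes S :: "'w set \<Rightarrow> 'w set \<Rightarrow> bool"
  assumes S_Co: "S A B \<Longrightarrow> A \<in> Co W \<and> B \<in> Co W"
    and S_empty: "S A B \<Longrightarrow> A = {} \<longleftrightarrow> B = {}"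
    and forth_step: "\<lbrakk>S A B; C \<in> Co W; C \<subseteq> A\<rbrakk> \<Longrightarrow> \<exists>D. D \<subseteq> B \<and> S C D \<and> S (A - C) (B - D)"
    and back_step: "\<lbrakk>S A B; D \<in> Co W; D \<subseteq> B\<rbrakk> \<Longrightarrow> \<exists>C. C \<subseteq> A \<and> S C D \<and> S (A - C) (B - D)"
begin

text \<open>
  The set \<open>C\<close> is matched from left to right, and then each of the two halves is cut along \<open>C\<close> on the
  right and matched backwards.
\<close>

lemma refine_pair:
  assumes S: "S A B" and C: "C \<in> Co W"
  shows "\<exists>N. splits N A B \<and> decides N C \<and> (\<forall>(A', B')\<in>N. S A' B')"
proof -
  obtain D where D: "D \<subseteq> B" "S (A \<inter> C) D" "S (A - A \<inter> C) (B - D)"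
    using forth_step[OF S, of "A \<inter> C"] S_Co[OF S] C by blast
  have half: "\<exists>N. splits N A' B' \<and> (\<forall>(A'', B'')\<in>N. S A'' B'' \<and> (B'' \<subseteq> C \<or> B'' \<inter> C = {}))"
    if S': "S A' B'" for A' B'
  proof -
    obtain D' where "D' \<subseteq> A'" "S D' (B' \<inter> C)" "S (A' - D') (B' - B' \<inter> C)"
      using back_step[OF S', of "B' \<inter> C"] S_Co[OF S'] C by blast
    then show ?thesis
      by (intro exI[of _ "{(D', B' \<inter> C), (A' - D', B' - B' \<inter> C)}"] conjI splits_two) auto
  qed
  let ?M = "{(A \<inter> C, D), (A - A \<inter> C, B - D)}"
  have "\<forall>z\<in>?M. \<exists>N. splits N (fst z) (snd z) \<and>
          (\<forall>(A'', B'')\<in>N. S A'' B'' \<and> (B'' \<subseteq> C \<or> B'' \<inter> C = {}))"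
    using half[OF D(2)] half[OF D(3)] by simp
  from bchoice[OF this] obtain N where NN: "\<forall>z\<in>?M. splits (N z) (fst z) (snd z) \<and>
          (\<forall>(A'', B'')\<in>N z. S A'' B'' \<and> (B'' \<subseteq> C \<or> B'' \<inter> C = {}))" ..
  have N: "splits (N z) (fst z) (snd z)" if "z \<in> ?M" for z
    using bspec[OF NN that] by (rule conjunct1)
  have N2: "S A'' B'' \<and> (B'' \<subseteq> C \<or> B'' \<inter> C = {})" if "z \<in> ?M" "(A'', B'') \<in> N z" for z A'' B''
    using bspec[OF bspec[OF NN that(1), THEN conjunct2] that(2)] by simp
  show ?thesis
  proof (intro exI[of _ "\<Union>z\<in>?M. N z"] conjI)
    show "splits (\<Union>z\<in>?M. N z) A B"
    proof (rule splits_Union)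
      show "splits ?M A B" using D(1) by (intro splits_two) auto
    qed (rule N)
    show "\<forall>(A', B')\<in>\<Union>z\<in>?M. N z. S A' B'"
      using N2 by blast
    have "A'' \<subseteq> C \<or> A'' \<inter> C = {}" if "z \<in> ?M" "(A'', B'') \<in> N z" for z A'' B''
    proof -
      have "A'' \<subseteq> fst z" using splits_subset[OF N[OF that(1)] that(2)] by simp
      then show ?thesis using that(1) by auto
    qed
    then show "decides (\<Union>z\<in>?M. N z) C"
      unfolding decides_def using N2 by blast
  qed
qed

text \<open>
  Iterating the refinement over all compact open sets produces matched partitions of \<open>E\<close> and \<open>F\<close>
  whose members shrink to points on both sides, and hence a bijection between the points.
\<close>

theorem back_and_forth:
  assumes EF: "S E F"
  obtains h where "homeomorphic_map (subtopology W E) (subtopology W F) h"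
    and "\<And>w x. \<lbrakk>w \<in> E; \<And>A B. S A B \<Longrightarrow> w \<in> A \<longleftrightarrow> x \<in> B\<rbrakk> \<Longrightarrow> h w = x"
proof -
  define c where "c = from_nat_into (Co W)"
  have c: "range c = Co W"
    unfolding c_def using countable_Co by (intro range_from_nat_into) auto
  define ok where "ok = (\<lambda>M. splits M E F \<and> (\<forall>(A, B)\<in>M. S A B))"
  have "\<exists>M. \<forall>n::nat. ok (M n) \<and>
      (decides (M (Suc n)) (c n) \<and> (\<forall>z\<in>M (Suc n). \<exists>y\<in>M n. fst z \<subseteq> fst y \<and> snd z \<subseteq> snd y))"
  proof (rule dependent_nat_choice)
    show "\<exists>M. ok M"
      using EF by (intro exI[of _ "{(E, F)}"]) (auto simp: ok_def splits_def)
  next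
    fix M and n :: nat assume M: "ok M"
    have "c n \<in> Co W" using c by blast
    then have "\<forall>z\<in>M. \<exists>N. splits N (fst z) (snd z) \<and> decides N (c n) \<and> (\<forall>(A, B)\<in>N. S A B)"
      using refine_pair M unfolding ok_def by force
    then obtain N where N: "\<And>z. z \<in> M \<Longrightarrow> splits (N z) (fst z) (snd z)"
      and N2: "\<And>z. z \<in> M \<Longrightarrow> decides (N z) (c n)"
      and N3: "\<And>z. z \<in> M \<Longrightarrow> \<forall>(A, B)\<in>N z. S A B"
      unfolding bchoice_iff by blast
    have "ok (\<Union>z\<in>M. N z)"
      unfolding ok_def using splits_Union[OF _ N, of M E F] M N3 unfolding ok_def by blast
    moreover have "decides (\<Union>z\<in>M. N z) (c n)"
      using N2 unfolding decides_def by blast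
    moreover have "\<forall>z\<in>\<Union>z\<in>M. N z. \<exists>y\<in>M. fst z \<subseteq> fst y \<and> snd z \<subseteq> snd y"
      using splits_subset[OF N] by blast
    ultimately show "\<exists>M'. ok M' \<and>
        (decides M' (c n) \<and> (\<forall>z\<in>M'. \<exists>y\<in>M. fst z \<subseteq> fst y \<and> snd z \<subseteq> snd y))"
      by blast
  qed
  then obtain M where M: "\<And>n::nat. splits (M n) E F" "\<And>n A B. (A, B) \<in> M n \<Longrightarrow> S A B"
    "\<And>n. decides (M (Suc n)) (c n)"
    "\<And>n z. z \<in> M (Suc n) \<Longrightarrow> \<exists>y\<in>M n. fst z \<subseteq> fst y \<and> snd z \<subseteq> snd y"
    unfolding ok_def by blast
  have E: "E \<in> Co W" and F: "F \<in> Co W" using S_Co[OF EF] by auto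

  define G where "G = (\<lambda>w x. \<forall>n. \<exists>z\<in>M n. w \<in> fst z \<and> x \<in> snd z)"
  have G_sub: "w \<in> E \<and> x \<in> F" if "G w x" for w x
    using that splits_subset[OF M(1)[of 0]] unfolding G_def by blast

  \<comment> \<open>Each point of \<open>E\<close> is followed down the refinements; on the other side the matched sets are
    decreasing and non-empty.\<close>
  have total: "\<exists>x. G w x" if w: "w \<in> E" for w
  proof -
    have "\<forall>n. \<exists>z. z \<in> M n \<and> w \<in> fst z"
      using splits_cover(1)[OF M(1) w] by blast
    then obtain z where z: "\<And>n. z n \<in> M n" "\<And>n. w \<in> fst (z n)" by metis
    have "snd (z (Suc n)) \<subseteq> snd (z n)" for n
    proof -
      obtain y where y: "y \<in> M n" "fst (z (Suc n)) \<subseteq> fst y" "snd (z (Suc n)) \<subseteq> snd y"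
        using M(4)[OF z(1)] by blast
      then have "y = z n" using splits_unique_fst[OF M(1)] z by (meson subsetD)
      then show ?thesis using y by simp
    qed
    moreover have "S (fst (z n)) (snd (z n))" for n using M(2)[of "fst (z n)" "snd (z n)" n] z(1)[of n] by simp
    ultimately obtain x where "\<And>n. x \<in> snd (z n)"
      using Co_nest_nonempty[of "\<lambda>n. snd (z n)"] S_Co S_empty z(2) by (metis empty_iff)
    then show ?thesis unfolding G_def using z by blast
  qed
  have onto: "\<exists>w. G w x" if x: "x \<in> F" for x
  proof -
    have "\<forall>n. \<exists>z. z \<in> M n \<and> x \<in> snd z"
      using splits_cover(2)[OF M(1) x] by blast
    then obtain z where z: "\<And>n. z n \<in> M n" "\<And>n. x \<in> snd (z n)" by metis
    have "fst (z (Suc n)) \<subseteq> fst (z n)" for n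
    proof -
      obtain y where y: "y \<in> M n" "fst (z (Suc n)) \<subseteq> fst y" "snd (z (Suc n)) \<subseteq> snd y"
        using M(4)[OF z(1)] by blast
      then have "y = z n" using splits_unique_snd[OF M(1)] z by (meson subsetD)
      then show ?thesis using y by simp
    qed
    moreover have "S (fst (z n)) (snd (z n))" for n using M(2)[of "fst (z n)" "snd (z n)" n] z(1)[of n] by simp
    ultimately obtain w where "\<And>n. w \<in> fst (z n)"
      using Co_nest_nonempty[of "\<lambda>n. fst (z n)"] S_Co S_empty z(2) by (metis empty_iff)
    then show ?thesis unfolding G_def using z by blast
  qed
  \<comment> \<open>A set separating two points is decided at some stage.\<close>
  have unique: "x = y" if G1: "G w x" and G2: "G w y" for w x y
  proof (rule ccontr)
    assume "x \<noteq> y"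
    then obtain C where C: "C \<in> Co W" "x \<in> C" "y \<notin> C"
      using Co_separate G_sub[OF G1] Co_subset_topspace[OF F] by blast
    then obtain n where n: "C = c n" using c by blast
    obtain z where z: "z \<in> M (Suc n)" "w \<in> fst z" "x \<in> snd z"
      using G1 unfolding G_def by blast
    obtain z' where z': "z' \<in> M (Suc n)" "w \<in> fst z'" "y \<in> snd z'"
      using G2 unfolding G_def by blast
    have "z = z'" using splits_unique_fst[OF M(1) z(1) z'(1)] z(2) z'(2) by blast
    then show False
      using decidesD(2)[OF M(3) z(1)] z z' C n by blast
  qed
  have inj: "w = v" if G1: "G w x" and G2: "G v x" for w v x
  proof (rule ccontr)
    assume "w \<noteq> v"
    then obtain C where C: "C \<in> Co W" "w \<in> C" "v \<notin> C"
      using Co_separate G_sub[OF G1] Co_subset_topspace[OF E] by blast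
    then obtain n where n: "C = c n" using c by blast
    obtain z where z: "z \<in> M (Suc n)" "w \<in> fst z" "x \<in> snd z"
      using G1 unfolding G_def by blast
    obtain z' where z': "z' \<in> M (Suc n)" "v \<in> fst z'" "x \<in> snd z'"
      using G2 unfolding G_def by blast
    have "z = z'" using splits_unique_snd[OF M(1) z(1) z'(1)] z(3) z'(3) by blast
    then show False
      using decidesD(1)[OF M(3) z(1)] z z' C n by blast
  qed
  define h where "h = (\<lambda>w. THE x. G w x)"
  have h: "G w (h w)" if "w \<in> E" for w
    unfolding h_def using total[OF that] unique by (metis the_equality)
  have image: "h ` E = F"
  proof
    show "h ` E \<subseteq> F" using h G_sub by blast
    show "F \<subseteq> h ` E"
    proof
      fix x assume "x \<in> F"
      then obtain w where w: "G w x" using onto by blast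
      then have "w \<in> E" "h w = x" using G_sub h unique by blast+
      then show "x \<in> h ` E" by blast
    qed
  qed
  have inj_h: "inj_on h E"
    using h inj by (metis inj_on_def)
  have topE: "topspace (subtopology W E) = E" and topF: "topspace (subtopology W F) = F"
    using Co_subset_topspace E F by auto
  have "continuous_map (subtopology W E) (subtopology W F) h"
    unfolding continuous_map_eq_topcontinuous_at topcontinuous_at_def topE topF
  proof (intro ballI conjI allI impI)
    fix w assume w: "w \<in> E"
    show "w \<in> E" by fact
    show "h \<in> E \<rightarrow> F" using image by blast
    fix V assume V: "openin (subtopology W F) V \<and> h w \<in> V"
    then obtain U where U: "openin W U" "V = U \<inter> F"
      by (auto simp: openin_subtopology)
    then obtain C where C: "C \<in> Co W" "h w \<in> C" "C \<subseteq> U" using Co_base V by blast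
    then obtain n where n: "C = c n" using c by blast
    obtain z where z: "z \<in> M (Suc n)" "w \<in> fst z" "h w \<in> snd z"
      using h[OF w] unfolding G_def by blast
    have z_sub: "fst z \<subseteq> E" "snd z \<subseteq> F"
      using splits_subset[OF M(1) z(1)] by blast+
    have "snd z \<subseteq> C"
      using decidesD(2)[OF M(3) z(1)] z C n by blast
    then have sV: "snd z \<subseteq> V" using U C z_sub by blast
    have "h y \<in> snd z" if y: "y \<in> fst z" for y
    proof -
      obtain z' where z': "z' \<in> M (Suc n)" "y \<in> fst z'" "h y \<in> snd z'"
        using h[of y] y z_sub unfolding G_def by blast
      then have "z' = z" using splits_unique_fst[OF M(1) z'(1) z(1)] y by blast
      then show ?thesis using z' by simp
    qed
    moreover have "openin (subtopology W E) (fst z)"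
      using M(2)[of "fst z" "snd z" "Suc n"] z S_Co Co_openin z_sub
      by (metis inf.absorb2 openin_subtopology_Int2 prod.collapse)
    ultimately show "\<exists>U. openin (subtopology W E) U \<and> w \<in> U \<and> (\<forall>y\<in>U. h y \<in> V)"
      using z sV by blast
  qed
  moreover have "compact_space (subtopology W E)"
    using E Co_compactin compact_space_subtopology by blast
  moreover have "Hausdorff_space (subtopology W F)"
    using Hausdorff Hausdorff_space_subtopology by blast
  ultimately have homeo: "homeomorphic_map (subtopology W E) (subtopology W F) h"
    using continuous_imp_homeomorphic_map image inj_h topE topF by metis
  have "h w = x" if w: "w \<in> E" and wx: "\<And>A B. S A B \<Longrightarrow> w \<in> A \<longleftrightarrow> x \<in> B" for w x
  proof -
    have "G w x"
      unfolding G_def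
    proof
      fix n
      obtain z where z: "z \<in> M n" "w \<in> fst z"
        using splits_cover(1)[OF M(1) w] by blast
      moreover have "S (fst z) (snd z)" using M(2) z by simp
      ultimately show "\<exists>z\<in>M n. w \<in> fst z \<and> x \<in> snd z" using wx by blast
    qed
    then show ?thesis using h[OF w] unique by blast
  qed
  with homeo show thesis using that by blast
qed

end

section \<open>Trim sets\<close>

locale trim_part = omega_stone W for W :: "'w topology" +
  fixes P :: "'p po_sys" and X :: "'p \<Rightarrow> 'w set"
  assumes trim_partition: "trim_partition W P X"
begin

abbreviation less (infix \<open>\<triangleleft>\<close> 50) where "less \<equiv> po_less P"
abbreviation leq (infix \<open>\<unlhd>\<close> 50) where "leq \<equiv> po_leq P"
abbreviation "C \<equiv> po_carrier P"
abbreviation "Tr \<equiv> Trim W P X"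
abbreviation "I \<equiv> point_types W P X"

lemma po_system: "po_system P"
  using trim_partition by (simp add: trim_partition_def po_partition_def)

lemma less_trans: "\<lbrakk>p \<in> C; q \<in> C; r \<in> C; p \<triangleleft> q; q \<triangleleft> r\<rbrakk> \<Longrightarrow> p \<triangleleft> r"
  using po_system unfolding po_system_def by (blast dest: transp_onD)

lemma leq_refl [simp]: "p \<unlhd> p"
  by (simp add: po_leq_def)

lemma leq_trans: "\<lbrakk>p \<in> C; q \<in> C; r \<in> C; p \<unlhd> q; q \<unlhd> r\<rbrakk> \<Longrightarrow> p \<unlhd> r"
  unfolding po_leq_def using less_trans by blast

lemma leq_antisym: "\<lbrakk>p \<in> C; q \<in> C; p \<unlhd> q; q \<unlhd> p\<rbrakk> \<Longrightarrow> p = q"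
  using po_system unfolding po_system_def po_leq_def by (blast dest: antisymp_onD)

lemma X_nonempty: "p \<in> C \<Longrightarrow> X p \<noteq> {}"
  and X_subset: "p \<in> C \<Longrightarrow> X p \<subseteq> topspace W"
  using trim_partition by (auto simp: trim_partition_def po_partition_def)

lemma X_disjoint: "\<lbrakk>p \<in> C; q \<in> C; w \<in> X p; w \<in> X q\<rbrakk> \<Longrightarrow> p = q"
  using trim_partition
  unfolding trim_partition_def po_partition_def disjoint_family_on_def by blast

lemma limit_iff:
  assumes "p \<in> C" "q \<in> C" "w \<in> X p"
  shows "w \<in> W derived_set_of X q \<longleftrightarrow> p \<triangleleft> q"
proof -
  have eq: "(W derived_set_of X q) \<inter> family_union P X = (\<Union>r\<in>{r \<in> C. r \<triangleleft> q}. X r)"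
    using trim_partition assms(2) unfolding trim_partition_def po_partition_def by blast
  have "w \<in> family_union P X" using assms by (auto simp: family_union_def)
  then have "w \<in> W derived_set_of X q \<longleftrightarrow> w \<in> (\<Union>r\<in>{r \<in> C. r \<triangleleft> q}. X r)"
    using eq by blast
  also have "\<dots> \<longleftrightarrow> p \<triangleleft> q" using assms X_disjoint by blast
  finally show ?thesis .
qed

lemma limit_point:
  assumes "p \<in> C" "q \<in> C" "p \<triangleleft> q" "w \<in> X p" "openin W U" "w \<in> U"
  shows "\<exists>b. b \<in> X q \<and> b \<in> U \<and> b \<noteq> w"
  using limit_iff[OF assms(1,2,4)] assms(3,5,6) unfolding in_derived_set_of by metis

lemma Trim_Co: "A \<in> Tr p \<Longrightarrow> A \<in> Co W"
  by (simp add: Trim_def)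

lemma Trim_meets_iff: "\<lbrakk>A \<in> Tr p; q \<in> C\<rbrakk> \<Longrightarrow> A \<inter> X q \<noteq> {} \<longleftrightarrow> p \<unlhd> q"
  by (auto simp: Trim_def type_set_def po_up_def)

lemma Trim_meets: "\<lbrakk>A \<in> Tr p; p \<in> C\<rbrakk> \<Longrightarrow> A \<inter> X p \<noteq> {}"
  by (simp add: Trim_meets_iff)

lemma Trim_point_leq: "\<lbrakk>A \<in> Tr p; q \<in> C; w \<in> A; w \<in> X q\<rbrakk> \<Longrightarrow> p \<unlhd> q"
  using Trim_meets_iff by blast

lemma Trim_card: "\<lbrakk>A \<in> Tr p; p \<in> C; \<not> p \<triangleleft> p\<rbrakk> \<Longrightarrow> card (A \<inter> X p) = 1"
  by (simp add: Trim_def po_irrefl_def)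

lemma Trim_single:
  assumes "A \<in> Tr p" "p \<in> C" "\<not> p \<triangleleft> p" "w \<in> A \<inter> X p" "x \<in> A \<inter> X p"
  shows "w = x"
proof -
  obtain z where "A \<inter> X p = {z}" using Trim_card[OF assms(1-3)] card_1_singletonE by blast
  then show ?thesis using assms(4,5) by (metis singletonD)
qed

lemma Trim_subset_leq: "\<lbrakk>A \<in> Tr p; B \<in> Tr q; q \<in> C; B \<subseteq> A\<rbrakk> \<Longrightarrow> p \<unlhd> q"
  using Trim_meets_iff[of A p q] Trim_meets[of B q] by blast

lemma TrimI:
  assumes "A \<in> Co W" "\<And>q. q \<in> C \<Longrightarrow> A \<inter> X q \<noteq> {} \<longleftrightarrow> p \<unlhd> q"
    and "\<lbrakk>p \<in> C; \<not> p \<triangleleft> p\<rbrakk> \<Longrightarrow> card (A \<inter> X p) = 1"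
  shows "A \<in> Tr p"
  using assms by (auto simp: Trim_def type_set_def po_up_def po_irrefl_def)

lemma trim_base:
  assumes "openin W U" "w \<in> U"
  shows "\<exists>p A. p \<in> C \<and> A \<in> Tr p \<and> w \<in> A \<and> A \<subseteq> U"
proof -
  have "neighbourhood_base_at w (trim_set W P X) W"
    using trim_partition assms openin_subset
    unfolding trim_partition_def T1_condition_def by blast
  then have "\<exists>N A. openin W N \<and> trim_set W P X A \<and> w \<in> N \<and> N \<subseteq> A \<and> A \<subseteq> U"
    using assms unfolding neighbourhood_base_at_def by simp
  then obtain N A where "w \<in> N" "N \<subseteq> A" "A \<subseteq> U" "trim_set W P X A" by blast
  then show ?thesis unfolding trim_set_def by blast
qed

text \<open>
  A trim set of type \<open>q\<close> inside a \<open>p\<close>-trim neighbourhood of \<open>w\<close> satisfies \<open>p \<le> q\<close>, and \<open>q \<le> p\<close>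
  because it contains \<open>w\<close>.
\<close>

lemma trim_base_typed:
  assumes "p \<in> C" "w \<in> X p" "openin W U" "w \<in> U"
  shows "\<exists>A. A \<in> Tr p \<and> w \<in> A \<and> A \<subseteq> U"
proof -
  obtain A0 where A0: "A0 \<in> Tr p" "w \<in> A0"
    using trim_partition assms unfolding trim_partition_def T3_condition_def by blast
  then have "openin W (U \<inter> A0)" using assms Trim_Co Co_openin by blast
  then obtain q A where A: "q \<in> C" "A \<in> Tr q" "w \<in> A" "A \<subseteq> U \<inter> A0"
    using trim_base[of "U \<inter> A0" w] assms A0 by blast
  have "q \<unlhd> p" using Trim_point_leq A assms by blast
  moreover have "p \<unlhd> q" using Trim_subset_leq A A0 by blast
  ultimately have "q = p" using leq_antisym A assms by blast
  then show ?thesis using A by blast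
qed

text \<open>
  A single point of type \<open>p\<close> is enough, since it has a \<open>p\<close>-trim neighbourhood in \<open>B\<close>, and this meets
  all the members of the partition that \<open>A\<close> meets.
\<close>

lemma Trim_subset:
  assumes A: "A \<in> Tr p" and p: "p \<in> C" and B: "B \<in> Co W" "B \<subseteq> A" "B \<inter> X p \<noteq> {}"
  shows "B \<in> Tr p"
proof (rule TrimI)
  obtain x where x: "x \<in> B" "x \<in> X p" using B by blast
  then obtain D where D: "D \<in> Tr p" "D \<subseteq> B"
    using trim_base_typed[OF p, of x B] B Co_openin by blast
  show "B \<inter> X q \<noteq> {} \<longleftrightarrow> p \<unlhd> q" if "q \<in> C" for q
    using Trim_meets_iff[OF A that] Trim_meets_iff[OF D(1) that] D B by blast
  show "card (B \<inter> X p) = 1" if "\<not> p \<triangleleft> p"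
  proof -
    have "B \<inter> X p = {x}"
      using Trim_single[OF A p that] x B by blast
    then show ?thesis by simp
  qed
qed (use B in simp)

lemma Trim_Un:
  assumes A: "A \<in> Tr p" and p: "p \<in> C" and B: "B \<in> Co W"
    and up: "\<And>q. \<lbrakk>q \<in> C; B \<inter> X q \<noteq> {}\<rbrakk> \<Longrightarrow> p \<unlhd> q" and single: "B \<inter> X p \<subseteq> A"
  shows "A \<union> B \<in> Tr p"
proof (rule TrimI)
  show "(A \<union> B) \<inter> X q \<noteq> {} \<longleftrightarrow> p \<unlhd> q" if "q \<in> C" for q
    using Trim_meets_iff[OF A that] up[OF that] by blast
  have "(A \<union> B) \<inter> X p = A \<inter> X p" using single by blast
  then show "card ((A \<union> B) \<inter> X p) = 1" if "\<not> p \<triangleleft> p"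
    using Trim_card[OF A p that] by simp
qed (use A B Trim_Co in blast)

text \<open>
  By antisymmetry \<open>B\<close> has no points of type \<open>p\<close>, so their number does not change, however \<open>A\<close> and \<open>B\<close>
  are placed.
\<close>

lemma Trim_absorb:
  assumes "A \<in> Tr p" "B \<in> Tr q" "p \<in> C" "q \<in> C" "p \<unlhd> q" "p \<noteq> q"
  shows "A \<union> B \<in> Tr p"
proof (rule Trim_Un)
  show "p \<unlhd> r" if "r \<in> C" "B \<inter> X r \<noteq> {}" for r
    using Trim_meets_iff[OF assms(2) that(1)] that(2) leq_trans[of p q r] assms \<open>r \<in> C\<close> by blast
  have "B \<inter> X p = {}"
    using Trim_meets_iff[OF assms(2,3)] leq_antisym[of p q] assms by blast
  then show "B \<inter> X p \<subseteq> A" by blast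
qed (use assms Trim_Co in auto)

section \<open>Types of points\<close>

lemma types_iff: "p \<in> I w \<longleftrightarrow> p \<in> C \<and> (\<exists>A\<in>Tr p. w \<in> A)"
  by (simp add: point_types_def)

text \<open>
  A small trim neighbourhood of \<open>w\<close> may have a type greater than \<open>q\<close>; it is then joined with a \<open>q\<close>-trim
  neighbourhood of some other point of \<open>B\<close>, which absorbs it.
\<close>

lemma trim_through_point:
  assumes B: "B \<in> Co W" "w \<in> B" and q: "q \<in> I w" "B \<inter> X q \<noteq> {}"
  shows "\<exists>E. E \<in> Tr q \<and> w \<in> E \<and> E \<subseteq> B"
proof -
  obtain A where A: "A \<in> Tr q" "w \<in> A" and qC: "q \<in> C" using q(1)[unfolded types_iff] by blast
  have "openin W (A \<inter> B)" using A B Trim_Co Co_openin by blast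
  then obtain r D where D: "r \<in> C" "D \<in> Tr r" "w \<in> D" "D \<subseteq> A \<inter> B"
    using trim_base[of "A \<inter> B" w] A B by blast
  have "q \<unlhd> r" using Trim_subset_leq A D by blast
  show ?thesis
  proof (cases "q = r")
    case True
    then show ?thesis using D by blast
  next
    case False
    obtain b where "b \<in> B" "b \<in> X q" using q by blast
    then obtain F where F: "F \<in> Tr q" "F \<subseteq> B"
      using trim_base_typed[OF qC, of b B] B Co_openin by blast
    then have "F \<union> D \<in> Tr q" using Trim_absorb D qC \<open>q \<unlhd> r\<close> False by blast
    then show ?thesis using D F by blast
  qed
qed

text \<open>
  The ideal is downwards closed because a trim neighbourhood of \<open>w\<close> is absorbed by trim sets of
  smaller type, and directed because two trim neighbourhoods have a common trim refinement.
\<close>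

lemma types_ideal:
  assumes w: "w \<in> topspace W"
  shows "po_ideal P (I w)"
  unfolding po_ideal_def
proof (intro conjI ballI impI)
  show "I w \<subseteq> C" using types_iff by blast
  obtain p A where "p \<in> C" "A \<in> Tr p" "w \<in> A"
    using trim_base[OF openin_topspace w] by blast
  then have "p \<in> I w" using types_iff by blast
  then show "I w \<noteq> {}" by blast
next
  fix p q assume p: "p \<in> I w" and q: "q \<in> C" and le: "q \<unlhd> p"
  show "q \<in> I w"
  proof (cases "q = p")
    case True
    then show ?thesis using p by simp
  next
    case False
    obtain A where A: "p \<in> C" "A \<in> Tr p" "w \<in> A" using p types_iff by blast
    obtain b where "b \<in> X q" using X_nonempty q by blast
    then obtain F where "F \<in> Tr q"
      using trim_base_typed[OF q, of b "topspace W"] X_subset[OF q] by blast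
    then have "F \<union> A \<in> Tr q" using Trim_absorb A q le False by blast
    then show ?thesis using q A types_iff by blast
  qed
next
  fix p q assume p: "p \<in> I w" and q: "q \<in> I w"
  obtain A where A: "p \<in> C" "A \<in> Tr p" "w \<in> A" using p types_iff by blast
  obtain B where B: "q \<in> C" "B \<in> Tr q" "w \<in> B" using q types_iff by blast
  note AB = A B
  then have "openin W (A \<inter> B)" using Trim_Co Co_openin by blast
  then obtain r D where D: "r \<in> C" "D \<in> Tr r" "w \<in> D" "D \<subseteq> A \<inter> B"
    using trim_base[of "A \<inter> B" w] AB by blast
  have "p \<unlhd> r" "q \<unlhd> r" using Trim_subset_leq AB D by blast+
  then show "\<exists>r\<in>I w. p \<unlhd> r \<and> q \<unlhd> r" using D types_iff by blast
qed

lemma types_of_X: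
  assumes p: "p \<in> C" and w: "w \<in> X p"
  shows "I w = po_down P p"
proof -
  have wt: "w \<in> topspace W" using X_subset p w by blast
  obtain A where "A \<in> Tr p" "w \<in> A"
    using trim_base_typed[OF p w openin_topspace wt] by blast
  then have "p \<in> I w" using p types_iff by blast
  then have "po_down P p \<subseteq> I w"
    using types_ideal[OF wt] unfolding po_ideal_def po_down_def by blast
  moreover have "I w \<subseteq> po_down P p"
    using Trim_point_leq[OF _ p _ w] unfolding types_iff po_down_def subset_iff by blast
  ultimately show ?thesis by blast
qed

text \<open>
  A trim neighbourhood of \<open>w\<close> inside a \<open>p\<close>-trim one has type at least \<open>p\<close>, and at most \<open>p\<close> because its
  type belongs to \<open>I\<^sub>w\<close>.  Hence \<open>w\<close> has a base of \<open>p\<close>-trim neighbourhoods, and T2 applies.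
\<close>

lemma in_X_if_types:
  assumes p: "p \<in> C" and w: "w \<in> topspace W" and Iw: "I w = po_down P p"
  shows "w \<in> X p"
proof -
  have "p \<in> I w" using Iw p by (simp add: po_down_def)
  then obtain A where A: "A \<in> Tr p" "w \<in> A" using types_iff by blast
  have "neighbourhood_base_at w (\<lambda>B. B \<in> Tr p) W"
    unfolding neighbourhood_base_at_def
  proof (intro allI impI)
    fix V assume V: "openin W V \<and> w \<in> V"
    then have "openin W (V \<inter> A)" using A Trim_Co Co_openin by blast
    then obtain q B where B: "q \<in> C" "B \<in> Tr q" "w \<in> B" "B \<subseteq> V \<inter> A"
      using trim_base[of "V \<inter> A" w] V A by blast
    then have "q \<in> I w" using types_iff by blast
    then have "q \<unlhd> p" using Iw by (simp add: po_down_def)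
    moreover have "p \<unlhd> q" using Trim_subset_leq A B by blast
    ultimately have "q = p" using leq_antisym B p by blast
    then have "openin W B \<and> B \<in> Tr p \<and> w \<in> B \<and> B \<subseteq> B \<and> B \<subseteq> V"
      using B Co_openin[OF Trim_Co[OF B(2)]] by blast
    then show "\<exists>U B. openin W U \<and> B \<in> Tr p \<and> w \<in> U \<and> U \<subseteq> B \<and> B \<subseteq> V" by blast
  qed
  moreover have "p \<in> trim_types W P X" using p A by (auto simp: trim_types_def)
  ultimately show ?thesis
    using trim_partition w unfolding trim_partition_def T2_condition_def by blast
qed

section \<open>Splitting trim sets\<close>

text \<open>
  A trim piece of type \<open>q > p\<close> can be taken out of a \<open>p\<close>-trim set without changing its type, as long
  as one point of type \<open>p\<close> is left; such a point is a limit of points of type \<open>q\<close>.  The piece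
  can be made to avoid a given point \<open>x\<close> or, by the lemma after this one, to contain it.
\<close>

lemma trim_piece_avoiding:
  assumes B: "B \<in> Tr p" and p: "p \<in> C" and q: "q \<in> C" and less: "p \<triangleleft> q"
  shows "\<exists>E. E \<in> Tr q \<and> E \<subseteq> B \<and> x \<notin> E \<and> B - E \<in> Tr p"
proof -
  obtain y where y: "y \<in> B" "y \<in> X p" using Trim_meets[OF B p] by blast
  have BCo: "B \<in> Co W" using B Trim_Co by blast
  have "\<exists>b\<in>X q. b \<in> B \<and> b \<noteq> y \<and> b \<noteq> x"
  proof (cases "x = y")
    case True
    then show ?thesis using limit_point[OF p q less y(2) Co_openin[OF BCo] y(1)] by metis
  next
    case False
    then show ?thesis
      using limit_point[OF p q less y(2) Co_remove_point[OF BCo, of x]] y by blast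
  qed
  then obtain b where b: "b \<in> X q" "b \<in> B" "b \<noteq> y" "b \<noteq> x" by blast
  have "openin W ((B - {y}) \<inter> (B - {x}))"
    using Co_remove_point[OF BCo] by blast
  then obtain E where E: "E \<in> Tr q" "E \<subseteq> (B - {y}) \<inter> (B - {x})"
    using trim_base_typed[OF q b(1)] b by blast
  have "B - E \<in> Tr p"
    using E y BCo Trim_Co by (intro Trim_subset[OF B p]) auto
  then show ?thesis using E by blast
qed

lemma trim_piece_through:
  assumes B: "B \<in> Tr p" and p: "p \<in> C" and less: "p \<triangleleft> q" and x: "x \<in> B" and q: "q \<in> I x"
  shows "\<exists>E. E \<in> Tr q \<and> E \<subseteq> B \<and> x \<in> E \<and> B - E \<in> Tr p"
proof -
  have qC: "q \<in> C" using q types_iff by blast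
  have BCo: "B \<in> Co W" using B Trim_Co by blast
  \<comment> \<open>If \<open>x\<close> were the only point of type \<open>p\<close>, then \<open>q \<le> p\<close>, hence \<open>p = q < p\<close>, and \<open>x\<close> would be a
    limit of such points.\<close>
  have "\<exists>y\<in>B \<inter> X p. y \<noteq> x"
  proof -
    obtain y where y: "y \<in> B" "y \<in> X p" using Trim_meets[OF B p] by blast
    show ?thesis
    proof (cases "y = x")
      case True
      then have "q \<unlhd> p" using types_of_X[OF p y(2)] q by (simp add: po_down_def)
      then have "q = p" using leq_antisym[OF qC p] less by (simp add: po_leq_def)
      then show ?thesis
        using limit_point[OF p qC less y(2) Co_openin[OF BCo] y(1)] True by blast
    qed (use y in blast)
  qed
  then obtain y where y: "y \<in> B" "y \<in> X p" "y \<noteq> x" by blast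
  obtain b where b: "b \<in> X q" "b \<in> B" "b \<noteq> y"
    using limit_point[OF p qC less y(2) Co_openin[OF BCo] y(1)] by blast
  have "openin W ((B - {b}) \<inter> (B - {x}))"
    using Co_remove_point[OF BCo] by blast
  then obtain N where N: "N \<in> Co W" "y \<in> N" "N \<subseteq> (B - {b}) \<inter> (B - {x})"
    using Co_base[of _ y] y b by blast
  have "B - N \<in> Co W" "x \<in> B - N" "(B - N) \<inter> X q \<noteq> {}" using BCo N x b by auto
  then obtain E where E: "E \<in> Tr q" "x \<in> E" "E \<subseteq> B - N"
    using trim_through_point q by blast
  have "B - E \<in> Tr p"
    using E y N BCo Trim_Co by (intro Trim_subset[OF B p]) auto
  then show ?thesis using E by blast
qed

lemma Trim_Diff_or_Un:
  assumes "trim_set W P X A" "trim_set W P X B"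
  shows "trim_set W P X (B - A) \<or> trim_set W P X (A \<union> B)"
proof -
  obtain p q where A: "p \<in> C" "A \<in> Tr p" and B: "q \<in> C" "B \<in> Tr q"
    using assms unfolding trim_set_def by blast
  show ?thesis
  proof (cases "(B - A) \<inter> X q = {}")
    case False
    then have "B - A \<in> Tr q"
      using A B Trim_Co by (intro Trim_subset[OF B(2,1)]) auto
    then show ?thesis using B unfolding trim_set_def by blast
  next
    case True
    then have "A \<inter> X q \<noteq> {}" using Trim_meets[OF B(2,1)] by blast
    then have le: "p \<unlhd> q" using Trim_meets_iff[OF A(2) B(1)] by blast
    have "A \<union> B \<in> Tr p"
    proof (cases "p = q")
      case False
      then show ?thesis using Trim_absorb A B le by blast
    next
      case eq: True
      show ?thesis
      proof (rule Trim_Un[OF A(2,1)])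
        show "p \<unlhd> r" if "r \<in> C" "B \<inter> X r \<noteq> {}" for r
          using Trim_meets_iff[OF B(2) that(1)] that eq by blast
        show "B \<inter> X p \<subseteq> A" using True eq by blast
      qed (use B Trim_Co in blast)
    qed
    then show ?thesis using A unfolding trim_set_def by blast
  qed
qed

text \<open>
  The number of trim sets in a cover decreases: either \<open>A\<close> can be removed from all the
  others without spoiling them, or it can be merged with one of them.
\<close>

lemma trim_disjointify:
  assumes "finite \<A>" "\<And>A. A \<in> \<A> \<Longrightarrow> trim_set W P X A"
  shows "\<exists>\<D>. finite \<D> \<and> pairwise disjnt \<D> \<and> (\<forall>D\<in>\<D>. trim_set W P X D) \<and> \<Union>\<D> = \<Union>\<A>"
  using assms
proof (induction "card \<A>" arbitrary: \<A> rule: less_induct)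
  case less
  show ?case
  proof (cases "\<A> = {}")
    case True
    then show ?thesis by (intro exI[of _ "{}"]) auto
  next
    case False
    then obtain A where A: "A \<in> \<A>" by blast
    have card_pos: "card \<A> > 0" using A less.prems(1) card_gt_0_iff by blast
    show ?thesis
    proof (cases "\<forall>B\<in>\<A> - {A}. trim_set W P X (B - A)")
      case True
      let ?B = "(\<lambda>B. B - A) ` (\<A> - {A})"
      have "card ?B \<le> card (\<A> - {A})" using less.prems(1) by (intro card_image_le) auto
      also have "\<dots> < card \<A>" using A less.prems(1) by (rule card_Diff1_less[rotated])
      finally have "card ?B < card \<A>" .
      then have "\<exists>\<D>. finite \<D> \<and> pairwise disjnt \<D> \<and> (\<forall>D\<in>\<D>. trim_set W P X D) \<and> \<Union>\<D> = \<Union>?B"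
        by (rule less.hyps) (use less.prems(1) True in auto)
      then obtain \<D> where D: "finite \<D>" "pairwise disjnt \<D>" "\<forall>D\<in>\<D>. trim_set W P X D" "\<Union>\<D> = \<Union>?B"
        by (elim exE conjE) (rule that)
      have disj: "disjnt A D" if "D \<in> \<D>" for D
        using D(4) that unfolding disjnt_def by blast
      have "pairwise disjnt (insert A \<D>)"
        using D(2) disj by (auto simp: pairwise_insert disjnt_sym)
      moreover have "\<Union>(insert A \<D>) = \<Union>\<A>" using D(4) A by auto
      ultimately show ?thesis
        using D less.prems(2)[OF A] by (intro exI[of _ "insert A \<D>"]) auto
    next
      case False
      then obtain B where B: "B \<in> \<A>" "B \<noteq> A" "\<not> trim_set W P X (B - A)" by blast
      then have AB: "trim_set W P X (A \<union> B)"
        using Trim_Diff_or_Un less.prems(2) A by blast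
      let ?B = "insert (A \<union> B) (\<A> - {A} - {B})"
      have "card (\<A> - {A} - {B}) < card (\<A> - {A})"
        using B less.prems(1) by (intro card_Diff1_less) auto
      moreover have "card (\<A> - {A}) < card \<A>"
        using A less.prems(1) by (intro card_Diff1_less) auto
      moreover have "card ?B \<le> Suc (card (\<A> - {A} - {B}))" by (rule card_insert_le_m1) auto
      ultimately have "card ?B < card \<A>" by linarith
      then have "\<exists>\<D>. finite \<D> \<and> pairwise disjnt \<D> \<and> (\<forall>D\<in>\<D>. trim_set W P X D) \<and> \<Union>\<D> = \<Union>?B"
        by (rule less.hyps) (use less.prems AB in auto)
      moreover have "\<Union>?B = \<Union>\<A>" using A B by blast
      ultimately show ?thesis by simp
    qed
  qed
qed

lemma trim_decomposition:
  assumes A: "A \<in> Co W"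
  shows "\<exists>\<D>. finite \<D> \<and> pairwise disjnt \<D> \<and> (\<forall>D\<in>\<D>. trim_set W P X D) \<and> \<Union>\<D> = A"
proof -
  let ?U = "{B. trim_set W P X B \<and> B \<subseteq> A}"
  have "openin W B" if "B \<in> ?U" for B
    using that Trim_Co Co_openin unfolding trim_set_def by blast
  moreover have "A \<subseteq> \<Union>?U"
  proof
    fix w assume "w \<in> A"
    then obtain p B where "p \<in> C" "B \<in> Tr p" "w \<in> B" "B \<subseteq> A"
      using trim_base[OF Co_openin[OF A]] by blast
    then show "w \<in> \<Union>?U" unfolding trim_set_def by blast
  qed
  ultimately obtain F where F: "finite F" "F \<subseteq> ?U" "A \<subseteq> \<Union>F"
    using Co_compactin[OF A] unfolding compactin_def by meson
  then have "\<Union>F = A" by blast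
  then show ?thesis
    using trim_disjointify[of F] F(1,2) by auto
qed

section \<open>Trim sets of the same type are homeomorphic\<close>

text \<open>
  Two sets are matched when they are cut into the same number of trim pieces with the same types,
  where in addition the piece containing \<open>w\<close>, if any, faces the piece containing \<open>x\<close>.  The second
  condition forces the resulting homeomorphism to take \<open>w\<close> to \<open>x\<close>.
\<close>

inductive matched :: "'w \<Rightarrow> 'w \<Rightarrow> 'w set \<Rightarrow> 'w set \<Rightarrow> bool" for w x where
  matched_empty: "matched w x {} {}"
| matched_Un: "\<lbrakk>matched w x A B; p \<in> C; A' \<in> Tr p; B' \<in> Tr p; A \<inter> A' = {}; B \<inter> B' = {};
    w \<in> A' \<longleftrightarrow> x \<in> B'\<rbrakk> \<Longrightarrow> matched w x (A \<union> A') (B \<union> B')"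

lemma matched_Co: "matched w x A B \<Longrightarrow> A \<in> Co W \<and> B \<in> Co W"
  by (induction rule: matched.induct) (use Trim_Co in auto)

lemma matched_empty_iff: "matched w x A B \<Longrightarrow> A = {} \<longleftrightarrow> B = {}"
  by (induction rule: matched.induct) (use Trim_meets in auto)

lemma matched_point: "matched w x A B \<Longrightarrow> w \<in> A \<longleftrightarrow> x \<in> B"
  by (induction rule: matched.induct) auto

lemma matched_sym: "matched w x A B \<Longrightarrow> matched x w B A"
proof (induction rule: matched.induct)
  case matched_empty
  show ?case by (rule matched.matched_empty)
next
  case (matched_Un A B p A' B')
  then show ?case by (intro matched.matched_Un[of x w B A p B' A']) auto
qed

lemma matched_single:
  "\<lbrakk>p \<in> C; A \<in> Tr p; B \<in> Tr p; w \<in> A \<longleftrightarrow> x \<in> B\<rbrakk> \<Longrightarrow> matched w x A B"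
  using matched_Un[OF matched_empty, of p A B] by simp

lemma matched_disjoint_Un:
  "\<lbrakk>matched w x A' B'; matched w x A B; A \<inter> A' = {}; B \<inter> B' = {}\<rbrakk> \<Longrightarrow> matched w x (A \<union> A') (B \<union> B')"
proof (induction rule: matched.induct)
  case matched_empty
  then show ?case by simp
next
  case (matched_Un A1 B1 p A2 B2)
  have "matched w x (A \<union> A1) (B \<union> B1)" using matched_Un by blast
  then have "matched w x ((A \<union> A1) \<union> A2) ((B \<union> B1) \<union> B2)"
    by (rule matched.matched_Un) (use matched_Un in auto)
  then show ?case by (simp add: Un_assoc)
qed

text \<open>
  The pieces are copied into \<open>B\<close> one after the other, what remains of \<open>B\<close> being \<open>p\<close>-trim at each stage.
\<close>

lemma match_pieces:
  assumes "finite \<D>" "pairwise disjnt \<D>" "\<And>D. D \<in> \<D> \<Longrightarrow> \<exists>q\<in>C. p \<triangleleft> q \<and> D \<in> Tr q"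
    and "I w = I x" "p \<in> C" "B \<in> Tr p" "w \<in> \<Union>\<D> \<longrightarrow> x \<in> B"
  shows "\<exists>B'\<subseteq>B. matched w x (\<Union>\<D>) B' \<and> B - B' \<in> Tr p"
  using assms
proof (induction \<D> rule: finite_induct)
  case empty
  then show ?case using matched_empty by (intro exI[of _ "{}"]) auto
next
  case (insert D \<D>)
  have disj: "\<Union>\<D> \<inter> D = {}"
    using insert.prems(1) insert.hyps(2) unfolding pairwise_insert disjnt_def by blast
  have "\<exists>B'\<subseteq>B. matched w x (\<Union>\<D>) B' \<and> B - B' \<in> Tr p"
    using insert.prems by (intro insert.IH) (auto simp: pairwise_insert)
  then obtain B' where B': "B' \<subseteq> B" "matched w x (\<Union>\<D>) B'" "B - B' \<in> Tr p" by blast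
  obtain q where q: "q \<in> C" "p \<triangleleft> q" "D \<in> Tr q" using insert.prems(2) by blast
  have "\<exists>E\<in>Tr q. E \<subseteq> B - B' \<and> (w \<in> D \<longleftrightarrow> x \<in> E) \<and> B - B' - E \<in> Tr p"
  proof (cases "w \<in> D")
    case True
    then have "x \<in> B" "x \<notin> B'" using insert.prems(6) matched_point[OF B'(2)] disj by auto
    moreover have "q \<in> I x" using True q types_iff insert.prems(3) by blast
    ultimately show ?thesis
      using trim_piece_through[OF B'(3) insert.prems(4) q(2), of x] True by blast
  next
    case False
    then show ?thesis using trim_piece_avoiding[OF B'(3) insert.prems(4) q(1,2), of x] by blast
  qed
  then obtain E where E: "E \<in> Tr q" "E \<subseteq> B - B'" "w \<in> D \<longleftrightarrow> x \<in> E" "B - B' - E \<in> Tr p" by blast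
  have "matched w x (\<Union>\<D> \<union> D) (B' \<union> E)"
    using matched_Un[OF B'(2) q(1,3) E(1) disj _ E(3)] E(2) by blast
  moreover have "\<Union>\<D> \<union> D = \<Union>(insert D \<D>)" by blast
  moreover have "B - (B' \<union> E) = B - B' - E" by blast
  ultimately show ?case using E B' by (intro exI[of _ "B' \<union> E"]) auto
qed

text \<open>
  The part \<open>D\<close> is again \<open>p\<close>-trim.  The other part is a disjoint union of trim pieces of types \<open>q\<close> with
  \<open>p < q\<close>: equality \<open>q = p\<close> occurs only when \<open>p < p\<close>, as otherwise \<open>A\<close> has just one point of type \<open>p\<close>.
\<close>

lemma Trim_split_aux:
  assumes p: "p \<in> C" and A: "A \<in> Tr p" and B: "B \<in> Tr p" and wx: "w \<in> A \<longleftrightarrow> x \<in> B" "I w = I x"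
    and D: "D \<in> Co W" "D \<subseteq> A" "D \<inter> X p \<noteq> {}"
  shows "\<exists>E. E \<subseteq> B \<and> matched w x D E \<and> matched w x (A - D) (B - E)"
proof -
  have "A - D \<in> Co W" using A D Trim_Co by blast
  from trim_decomposition[OF this] obtain \<D>
    where \<D>: "finite \<D>" "pairwise disjnt \<D>" "\<forall>D\<in>\<D>. trim_set W P X D" "\<Union>\<D> = A - D"
    by (elim exE conjE) (rule that)
  have "\<exists>q\<in>C. p \<triangleleft> q \<and> K \<in> Tr q" if K: "K \<in> \<D>" for K
  proof -
    obtain q where q: "q \<in> C" "K \<in> Tr q" using bspec[OF \<D>(3) K] unfolding trim_set_def by blast
    have KA: "K \<subseteq> A - D" using K \<D>(4) by blast
    then have "p \<unlhd> q" using Trim_subset_leq[OF A q(2,1)] by blast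
    moreover have "p \<triangleleft> p" if pq: "p = q"
    proof (rule ccontr)
      assume irr: "\<not> p \<triangleleft> p"
      obtain y z where "y \<in> D" "y \<in> X p" "z \<in> K" "z \<in> X p"
        using D(3) Trim_meets[OF q(2,1)] unfolding pq[symmetric] by blast
      then show False using Trim_single[OF A p irr, of y z] KA D(2) by blast
    qed
    ultimately show ?thesis using q unfolding po_leq_def by blast
  qed
  moreover have "w \<in> \<Union>\<D> \<longrightarrow> x \<in> B" using wx(1) \<D>(4) by blast
  ultimately have "\<exists>B'\<subseteq>B. matched w x (\<Union>\<D>) B' \<and> B - B' \<in> Tr p"
    using match_pieces[OF \<D>(1,2) _ wx(2) p B] by blast
  then obtain B' where B': "B' \<subseteq> B" "matched w x (A - D) B'" "B - B' \<in> Tr p"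
    using \<D>(4) by auto
  have "D \<in> Tr p" using Trim_subset A p D by blast
  moreover have "w \<in> D \<longleftrightarrow> x \<in> B - B'" using matched_point[OF B'(2)] wx(1) D(2) B'(1) by blast
  ultimately have "matched w x D (B - B')" using matched_single[OF p _ B'(3)] by blast
  moreover have "B - (B - B') = B'" using B'(1) by blast
  ultimately show ?thesis using B' by (intro exI[of _ "B - B'"]) auto
qed

lemma Trim_split:
  assumes p: "p \<in> C" and A: "A \<in> Tr p" and B: "B \<in> Tr p" and wx: "w \<in> A \<longleftrightarrow> x \<in> B" "I w = I x"
    and D: "D \<in> Co W" "D \<subseteq> A"
  shows "\<exists>E. E \<subseteq> B \<and> matched w x D E \<and> matched w x (A - D) (B - E)"
proof (cases "D \<inter> X p = {}")
  case False
  then show ?thesis using Trim_split_aux[OF p A B wx D] by simp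
next
  case True
  then have "(A - D) \<inter> X p \<noteq> {}" using Trim_meets[OF A p] by blast
  moreover have "A - D \<in> Co W" using A D Trim_Co by blast
  ultimately obtain E where E: "E \<subseteq> B" "matched w x (A - D) E" "matched w x (A - (A - D)) (B - E)"
    using Trim_split_aux[OF p A B wx, of "A - D"] by blast
  moreover have "A - (A - D) = D" "B - (B - E) = E" using D E by auto
  ultimately show ?thesis by (intro exI[of _ "B - E"]) auto
qed

lemma matched_split:
  assumes "I w = I x" and "matched w x A B" "D \<in> Co W" "D \<subseteq> A"
  shows "\<exists>E. E \<subseteq> B \<and> matched w x D E \<and> matched w x (A - D) (B - E)"
  using assms(2-4)
proof (induction arbitrary: D rule: matched.induct)
  case matched_empty
  then show ?case using matched.matched_empty by auto
next
  case (matched_Un A B p A' B')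
  have Co: "D \<inter> A \<in> Co W" "D \<inter> A' \<in> Co W"
    using matched_Un.prems(1) matched_Co[OF matched_Un.hyps(1)] Trim_Co[OF matched_Un.hyps(3)]
    by auto
  obtain E where E: "E \<subseteq> B" "matched w x (D \<inter> A) E" "matched w x (A - D \<inter> A) (B - E)"
    using matched_Un.IH[OF Co(1)] by blast
  obtain E' where E': "E' \<subseteq> B'" "matched w x (D \<inter> A') E'" "matched w x (A' - D \<inter> A') (B' - E')"
    using Trim_split[OF matched_Un.hyps(2,3,4) matched_Un.hyps(7) assms(1) Co(2)] by blast
  have "matched w x (D \<inter> A \<union> D \<inter> A') (E \<union> E')"
    using matched_disjoint_Un[OF E'(2) E(2)] E(1) E'(1) matched_Un.hyps(5,6) by blast
  moreover have "D \<inter> A \<union> D \<inter> A' = D" using matched_Un.prems(2) by blast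
  moreover have "matched w x ((A - D \<inter> A) \<union> (A' - D \<inter> A')) ((B - E) \<union> (B' - E'))"
    using matched_disjoint_Un[OF E'(3) E(3)] matched_Un.hyps(5,6) by blast
  moreover have "(A - D \<inter> A) \<union> (A' - D \<inter> A') = A \<union> A' - D" by blast
  moreover have "(B - E) \<union> (B' - E') = B \<union> B' - (E \<union> E')"
    using E(1) E'(1) matched_Un.hyps(6) by blast
  ultimately show ?case using E(1) E'(1) by (intro exI[of _ "E \<union> E'"]) auto
qed

theorem Trim_homeomorphic:
  assumes p: "p \<in> C" and A: "A \<in> Tr p" and B: "B \<in> Tr p" and wx: "w \<in> A" "x \<in> B" "I w = I x"
  obtains h where "homeomorphic_map (subtopology W A) (subtopology W B) h" "h w = x"
proof -
  interpret zigzag W "matched w x"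
  proof
    fix A B D assume AB: "matched w x A B" and D: "D \<in> Co W"
    show "\<exists>E\<subseteq>B. matched w x D E \<and> matched w x (A - D) (B - E)" if "D \<subseteq> A"
      using matched_split[OF wx(3) AB D that] .
    show "\<exists>E\<subseteq>A. matched w x E D \<and> matched w x (A - E) (B - D)" if "D \<subseteq> B"
      using matched_split[OF wx(3)[symmetric] matched_sym[OF AB] D that] matched_sym by blast
  qed (fact matched_Co, fact matched_empty_iff)
  have "matched w x A B" using matched_single[OF p A B] wx by blast
  then show thesis using back_and_forth that matched_point wx by metis
qed

end

section \<open>Points of the same type lie in the same orbit\<close>

context omega_stone
begin

lemma swap_homeomorphism:
  assumes E: "E \<in> Co W" and F: "F \<in> Co W" and disj: "E \<inter> F = {}"
    and h: "homeomorphic_map (subtopology W E) (subtopology W F) h"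
  obtains g where "homeomorphic_map W W g" "\<And>w. w \<in> E \<Longrightarrow> g w = h w"
proof -
  have topE: "topspace (subtopology W E) = E" and topF: "topspace (subtopology W F) = F"
    using Co_subset_topspace E F by auto
  obtain k where hk: "homeomorphic_maps (subtopology W E) (subtopology W F) h k"
    using h homeomorphic_map_maps by blast
  then have ch: "continuous_map (subtopology W E) (subtopology W F) h"
    and ck: "continuous_map (subtopology W F) (subtopology W E) k"
    and kh: "\<And>w. w \<in> E \<Longrightarrow> k (h w) = w" and hk': "\<And>x. x \<in> F \<Longrightarrow> h (k x) = x"
    unfolding homeomorphic_maps_def topE topF by auto
  have h_in: "h w \<in> F" if "w \<in> E" for w
    using continuous_map_image_subset_topspace[OF ch] topE topF that by blast
  have k_in: "k x \<in> E" if "x \<in> F" for x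
    using continuous_map_image_subset_topspace[OF ck] topE topF that by blast
  define T where "T = (\<lambda>i::nat. if i = 0 then E else if i = 1 then F else topspace W - (E \<union> F))"
  define f where "f = (\<lambda>i::nat. if i = 0 then h else if i = 1 then k else (\<lambda>w. w))"
  define g where "g = (\<lambda>w. if w \<in> E then h w else if w \<in> F then k w else w)"
  have "closedin W (E \<union> F)" using E F Co_closedin by blast
  then have open_T: "openin W (T i)" for i
    using E F Co_openin unfolding T_def by auto
  have cont: "continuous_map W W g"
  proof (rule pasting_lemma[of "UNIV :: nat set" W T W f])
    show "openin W (T i)" for i by (rule open_T)
    show "continuous_map (subtopology W (T i)) W (f i)" for i
    proof -
      consider "i = 0" | "i = 1" | "i \<noteq> 0" "i \<noteq> 1" by blast
      then show ?thesis
      proof cases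
        case 1
        then show ?thesis
          using continuous_map_in_subtopology[of "subtopology W E" W F h] ch by (simp add: T_def f_def)
      next
        case 2
        then show ?thesis
          using continuous_map_in_subtopology[of "subtopology W F" W E k] ck by (simp add: T_def f_def)
      next
        case 3
        then have "f i = (\<lambda>w. w)" by (simp add: f_def)
        then show ?thesis by (simp add: continuous_map_from_subtopology)
      qed
    qed
    show "f i w = f j w" if "w \<in> topspace W \<inter> T i \<inter> T j" for i j w
      using that disj by (auto simp: T_def f_def split: if_splits)
    show "\<exists>j. j \<in> UNIV \<and> w \<in> T j \<and> g w = f j w" if "w \<in> topspace W" for w
    proof -
      consider "w \<in> E" | "w \<notin> E" "w \<in> F" | "w \<notin> E" "w \<notin> F" by blast
      then show ?thesis
      proof cases
        case 1
        then show ?thesis by (intro exI[of _ 0]) (simp add: T_def f_def g_def)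
      next
        case 2
        then show ?thesis by (intro exI[of _ 1]) (simp add: T_def f_def g_def)
      next
        case 3
        then show ?thesis using that by (intro exI[of _ 2]) (simp add: T_def f_def g_def)
      qed
    qed
  qed
  have "g (g w) = w" for w
    using h_in[of w] k_in[of w] kh hk' disj unfolding g_def by auto
  then have "homeomorphic_maps W W g g"
    using cont by (simp add: homeomorphic_maps_def)
  then have "homeomorphic_map W W g" using homeomorphic_map_maps by blast
  then show thesis using that[of g] by (simp add: g_def)
qed

end

context trim_part
begin

text \<open>
  The ideal contains a common upper bound \<open>r\<close> of the types of two disjoint neighbourhoods.  These can
  be shrunk to \<open>r\<close>-trim ones, which are then interchanged.
\<close>

theorem same_types_same_orbit:
  assumes w: "w \<in> topspace W" and x: "x \<in> topspace W" and types: "I w = I x"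
  shows "\<exists>g. homeomorphic_map W W g \<and> g w = x"
proof (cases "w = x")
  case True
  then show ?thesis using homeomorphic_map_id by (metis id_apply)
next
  case False
  obtain U V where UV: "openin W U" "openin W V" "w \<in> U" "x \<in> V" "disjnt U V"
    using Hausdorff w x False unfolding Hausdorff_space_def by metis
  obtain p A where A: "p \<in> C" "A \<in> Tr p" "w \<in> A" "A \<subseteq> U"
    using trim_base[OF UV(1,3)] by (elim exE conjE) (rule that)
  obtain q B where B: "q \<in> C" "B \<in> Tr q" "x \<in> B" "B \<subseteq> V"
    using trim_base[OF UV(2,4)] by (elim exE conjE) (rule that)
  have "p \<in> I w" using A types_iff by blast
  moreover have "q \<in> I w" unfolding types using B types_iff by blast
  ultimately obtain r where r: "r \<in> I w" "p \<unlhd> r" "q \<unlhd> r"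
    using types_ideal[OF w] unfolding po_ideal_def by blast
  have rC: "r \<in> C" using r(1) types_iff by blast
  have "A \<inter> X r \<noteq> {}" "B \<inter> X r \<noteq> {}"
    using Trim_meets_iff A B rC r by blast+
  then obtain E F where E: "E \<in> Tr r" "w \<in> E" "E \<subseteq> A" and F: "F \<in> Tr r" "x \<in> F" "F \<subseteq> B"
    using trim_through_point[OF Trim_Co[OF A(2)] A(3) r(1)]
      trim_through_point[OF Trim_Co[OF B(2)] B(3) r(1)[unfolded types]] by metis
  obtain h where h: "homeomorphic_map (subtopology W E) (subtopology W F) h" "h w = x"
    using Trim_homeomorphic[OF rC E(1) F(1) E(2) F(2) types] .
  have "E \<inter> F = {}" using E(3) F(3) A(4) B(4) UV(5) unfolding disjnt_def by blast
  from swap_homeomorphism[OF Trim_Co[OF E(1)] Trim_Co[OF F(1)] this h(1)]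
  show ?thesis using h(2) E(2) by metis
qed

section \<open>The partition indexed by the ideals\<close>

text \<open>
  Trim sets of different types are different, and there are only countably many compact open sets.
\<close>

lemma countable_carrier: "countable C"
proof -
  define f where "f = (\<lambda>p. SOME A. A \<in> Tr p)"
  have f: "f p \<in> Tr p" if p: "p \<in> C" for p
  proof -
    obtain b where b: "b \<in> X p" using X_nonempty[OF p] by blast
    then have "b \<in> topspace W" using X_subset[OF p] by blast
    from trim_base_typed[OF p b openin_topspace this] have "\<exists>A. A \<in> Tr p" by blast
    then show ?thesis unfolding f_def by (rule someI_ex)
  qed
  have "inj_on f C"
  proof (rule inj_onI)
    fix p q assume pq: "p \<in> C" "q \<in> C" "f p = f q"
    have "p \<unlhd> q" "q \<unlhd> p"
      using Trim_subset_leq[OF f[OF pq(1)] f[OF pq(2)] pq(2)]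
        Trim_subset_leq[OF f[OF pq(2)] f[OF pq(1)] pq(1)] pq(3) by auto
    then show "p = q" using leq_antisym pq(1,2) by blast
  qed
  moreover have "f ` C \<subseteq> Co W" using f Trim_Co by blast
  ultimately show ?thesis using countable_Co countable_image_inj_on countable_subset by metis
qed

lemma ideal_cofinal_sequence:
  assumes J: "po_ideal P J" and p: "p \<in> J"
  obtains s where "s 0 = p" "\<And>n. s n \<in> J" "\<And>n. s n \<unlhd> s (Suc n)" "\<And>q. q \<in> J \<Longrightarrow> \<exists>n. q \<unlhd> s n"
proof -
  have JC: "J \<subseteq> C" and up: "\<And>x y. \<lbrakk>x \<in> J; y \<in> J\<rbrakk> \<Longrightarrow> \<exists>z\<in>J. x \<unlhd> z \<and> y \<unlhd> z"
    using J unfolding po_ideal_def by blast+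
  define e where "e = from_nat_into J"
  have e: "range e = J"
    unfolding e_def using countable_subset[OF JC countable_carrier] p by (intro range_from_nat_into) auto
  have "\<exists>s. \<forall>n. (s n \<in> J \<and> (n = 0 \<longrightarrow> s n = p)) \<and> (s n \<unlhd> s (Suc n) \<and> e n \<unlhd> s (Suc n))"
  proof (rule dependent_nat_choice)
    show "\<exists>x. x \<in> J \<and> ((0::nat) = 0 \<longrightarrow> x = p)" using p by blast
  next
    fix x and n :: nat assume x: "x \<in> J \<and> (n = 0 \<longrightarrow> x = p)"
    moreover have "e n \<in> J" using e by blast
    ultimately show "\<exists>y. (y \<in> J \<and> (Suc n = 0 \<longrightarrow> y = p)) \<and> (x \<unlhd> y \<and> e n \<unlhd> y)"
      using up[of x "e n"] by auto
  qed
  then obtain s where s: "\<And>n. (s n \<in> J \<and> (n = 0 \<longrightarrow> s n = p)) \<and> (s n \<unlhd> s (Suc n) \<and> e n \<unlhd> s (Suc n))"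
    by blast
  have "\<exists>n. q \<unlhd> s n" if q: "q \<in> J" for q
  proof -
    obtain n where "q = e n" using e q by blast
    then show ?thesis using s[of n] by blast
  qed
  then show thesis using that[of s] s by simp
qed

text \<open>
  Trim sets whose types run through a cofinal sequence of the ideal shrink to a point: one half of
  a \<open>p\<close>-trim set is \<open>p\<close>-trim, and it contains trim sets of all greater types.
\<close>

theorem ideal_realised:
  assumes J: "po_ideal P J" and p: "p \<in> J" and A: "A \<in> Tr p"
  shows "\<exists>x\<in>A. I x = J"
proof -
  have JC: "J \<subseteq> C" and low: "\<And>x y. \<lbrakk>x \<in> J; y \<in> C; y \<unlhd> x\<rbrakk> \<Longrightarrow> y \<in> J"
    using J unfolding po_ideal_def by blast+
  obtain s where s: "s 0 = p" "\<And>n. s n \<in> J" "\<And>n. s n \<unlhd> s (Suc n)" "\<And>q. q \<in> J \<Longrightarrow> \<exists>n. q \<unlhd> s n"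
    using ideal_cofinal_sequence[OF J p] by blast
  have sC: "s n \<in> C" for n using s(2) JC by blast
  have step: "\<exists>E\<subseteq>B. E \<in> Tr (s (Suc n)) \<and> (E \<subseteq> D \<or> E \<inter> D = {})"
    if B: "B \<in> Tr (s n)" and D: "D \<in> Co W" for n B D
  proof -
    have half: "\<exists>H. H \<in> Tr (s n) \<and> H \<subseteq> B \<and> (H \<subseteq> D \<or> H \<inter> D = {})"
    proof (cases "B \<inter> D \<inter> X (s n) = {}")
      case False
      then have "B \<inter> D \<in> Tr (s n)"
        using Trim_Co[OF B] D by (intro Trim_subset[OF B sC]) auto
      then show ?thesis by blast
    next
      case True
      then have "(B - D) \<inter> X (s n) \<noteq> {}" using Trim_meets[OF B sC] by blast
      then have "B - D \<in> Tr (s n)"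
        using Trim_Co[OF B] D by (intro Trim_subset[OF B sC]) auto
      then show ?thesis by blast
    qed
    then obtain H where H: "H \<in> Tr (s n)" "H \<subseteq> B" "H \<subseteq> D \<or> H \<inter> D = {}" by blast
    have "H \<inter> X (s (Suc n)) \<noteq> {}" using Trim_meets_iff[OF H(1) sC] s(3) by blast
    then obtain b where b: "b \<in> H" "b \<in> X (s (Suc n))" by blast
    obtain E where "E \<in> Tr (s (Suc n))" "E \<subseteq> H"
      using trim_base_typed[OF sC b(2) Co_openin[OF Trim_Co[OF H(1)]] b(1)] by blast
    then show ?thesis using H by blast
  qed
  have ne: "\<And>n B. B \<in> Tr (s n) \<Longrightarrow> B \<noteq> {}" using Trim_meets[OF _ sC] by blast
  have start: "A \<in> Tr (s 0)" using A s(1) by simp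
  have "\<exists>x H. (\<forall>n. H n \<in> Tr (s n) \<and> x \<in> H n \<and> H n \<subseteq> A) \<and>
      (\<forall>U. openin W U \<and> x \<in> U \<longrightarrow> (\<exists>n. H n \<subseteq> U))"
    by (rule shrinking_sets[of "\<lambda>n A. A \<in> Tr (s n)", OF start])
      (fact Trim_Co, fact ne, fact step)
  then obtain x H where H_all: "\<forall>n. H n \<in> Tr (s n) \<and> x \<in> H n \<and> H n \<subseteq> A"
    and small: "\<forall>U. openin W U \<and> x \<in> U \<longrightarrow> (\<exists>n. H n \<subseteq> U)"
    by (elim exE conjE) (rule that)
  have H: "H n \<in> Tr (s n)" "x \<in> H n" "H n \<subseteq> A" for n
    using H_all by simp_all
  have xt: "x \<in> topspace W" using Co_subset_topspace[OF Trim_Co[OF H(1)]] H(2) by blast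
  have "I x = J"
  proof
    show "I x \<subseteq> J"
    proof
      fix q assume "q \<in> I x"
      then obtain B where B: "q \<in> C" "B \<in> Tr q" "x \<in> B" using types_iff by blast
      obtain n where "H n \<subseteq> B" using small Co_openin[OF Trim_Co[OF B(2)]] B(3) by blast
      then have "q \<unlhd> s n" using Trim_subset_leq[OF B(2) H(1) sC] by blast
      then show "q \<in> J" using low s(2) B(1) by blast
    qed
    show "J \<subseteq> I x"
    proof
      fix q assume q: "q \<in> J"
      then obtain n where n: "q \<unlhd> s n" using s(4) by blast
      have "s n \<in> I x" using sC H(1,2) types_iff by blast
      then show "q \<in> I x"
        using types_ideal[OF xt] n q JC unfolding po_ideal_def by blast
    qed
  qed
  then show ?thesis using H(2,3) by blast
qed

abbreviation "IP \<equiv> id_completion P"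
abbreviation "XI \<equiv> id_part W P X"

lemma id_carrier: "J \<in> po_carrier IP \<longleftrightarrow> po_ideal P J"
  by (simp add: id_completion_def)

lemma id_less: "po_less IP J K \<longleftrightarrow> J \<subset> K \<or> J = K \<and> J \<notin> po_down P ` po_irrefl P"
  by (simp add: id_completion_def)

lemma id_leq: "po_leq IP J K \<longleftrightarrow> J \<subseteq> K"
  by (auto simp: po_leq_def id_less)

lemma down_subset_ideal:
  assumes "po_ideal P J" "p \<in> C"
  shows "po_down P p \<subseteq> J \<longleftrightarrow> p \<in> J"
  using assms unfolding po_ideal_def po_down_def po_leq_def by blast

lemma down_ideal:
  assumes p: "p \<in> C"
  shows "po_ideal P (po_down P p)"
proof -
  obtain b where b: "b \<in> X p" using X_nonempty[OF p] by blast
  then have "b \<in> topspace W" using X_subset[OF p] by blast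
  then show ?thesis using types_ideal types_of_X[OF p b] by metis
qed

lemma down_inj:
  assumes p: "p \<in> C" and q: "q \<in> C" and eq: "po_down P p = po_down P q"
  shows "p = q"
proof (rule leq_antisym[OF p q])
  have "p \<in> po_down P p" "q \<in> po_down P q" using p q by (simp_all add: po_down_def)
  then have "p \<in> po_down P q" "q \<in> po_down P p" using eq by simp_all
  then show "p \<unlhd> q" "q \<unlhd> p" unfolding po_down_def by simp_all
qed

lemma XI_iff: "w \<in> XI J \<longleftrightarrow> w \<in> topspace W \<and> I w = J"
  by (simp add: id_part_def)

lemma XI_down:
  assumes p: "p \<in> C"
  shows "XI (po_down P p) = X p"
  using types_of_X[OF p] in_X_if_types[OF p] X_subset[OF p] unfolding XI_iff set_eq_iff by blast

lemma XI_nonempty: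
  assumes J: "po_ideal P J"
  shows "XI J \<noteq> {}"
proof -
  obtain p where p: "p \<in> J" "p \<in> C" using J unfolding po_ideal_def by blast
  obtain b where b: "b \<in> X p" using X_nonempty[OF p(2)] by blast
  then have "b \<in> topspace W" using X_subset[OF p(2)] by blast
  then obtain A where A: "A \<in> Tr p"
    using trim_base_typed[OF p(2) b openin_topspace] by blast
  then obtain x where "x \<in> A" "I x = J" using ideal_realised[OF J p(1)] by blast
  then show ?thesis using Co_subset_topspace[OF Trim_Co[OF A]] XI_iff by blast
qed

text \<open>
  Near \<open>w\<close> there are trim sets with types in \<open>J\<close>, and these contain points with ideal \<open>K\<close> as soon as
  \<open>J \<subseteq> K\<close>.  Only for \<open>J = K\<close> might the point found be \<open>w\<close> itself.  If \<open>J\<close> is generated by an element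
  \<open>p\<close> with \<open>p \<not>< p\<close>, this is what happens, because a \<open>p\<close>-trim set has a single point of type \<open>p\<close>.
\<close>

lemma XI_limit_iff:
  assumes J: "po_ideal P J" and K: "po_ideal P K" and w: "w \<in> XI J"
  shows "w \<in> W derived_set_of XI K \<longleftrightarrow> po_less IP J K"
proof
  have wt: "w \<in> topspace W" and Iw: "I w = J" using w XI_iff by auto
  have KC: "K \<subseteq> C" and K_up: "\<And>x y. \<lbrakk>x \<in> K; y \<in> K\<rbrakk> \<Longrightarrow> \<exists>z\<in>K. x \<unlhd> z \<and> y \<unlhd> z"
    using K unfolding po_ideal_def by blast+
  {
    assume lim: "w \<in> W derived_set_of XI K"
    have near: "\<exists>x\<in>A. x \<noteq> w \<and> I x = K" if A: "A \<in> Co W" "w \<in> A" for A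
      using lim Co_openin[OF A(1)] A(2) unfolding in_derived_set_of XI_iff by blast
    have "J \<subseteq> K"
    proof
      fix p assume "p \<in> J"
      then obtain A where A: "p \<in> C" "A \<in> Tr p" "w \<in> A" using Iw types_iff by blast
      then obtain x where "x \<in> A" "I x = K" using near Trim_Co by blast
      then show "p \<in> K" using A types_iff by blast
    qed
    moreover have "J \<notin> po_down P ` po_irrefl P" if JK: "J = K"
    proof
      assume "J \<in> po_down P ` po_irrefl P"
      then obtain p where p: "p \<in> C" "\<not> p \<triangleleft> p" "J = po_down P p"
        unfolding po_irrefl_def by blast
      then have wX: "w \<in> X p" using in_X_if_types wt Iw by blast
      have "p \<in> I w" using Iw p by (simp add: po_down_def)
      then obtain A where A: "A \<in> Tr p" "w \<in> A" using types_iff by blast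
      obtain x where x: "x \<in> A" "x \<noteq> w" "I x = K" using near[OF Trim_Co[OF A(1)] A(2)] by blast
      have "x \<in> X p"
        using in_X_if_types[OF p(1)] x Co_subset_topspace[OF Trim_Co[OF A(1)]] JK p(3) by blast
      then show False using Trim_single[OF A(1) p(1,2), of w x] wX A(2) x by blast
    qed
    ultimately show "po_less IP J K" unfolding id_less by blast
  }
  {
    assume less: "po_less IP J K"
    show "w \<in> W derived_set_of XI K"
      unfolding in_derived_set_of
    proof (intro conjI allI impI)
      show "w \<in> topspace W" by (rule wt)
      fix U assume U: "w \<in> U \<and> openin W U"
      obtain p A where A: "p \<in> C" "A \<in> Tr p" "w \<in> A" "A \<subseteq> U"
        using trim_base[of U w] U by blast
      have ACo: "A \<in> Co W" using Trim_Co A by blast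
      have "p \<in> J" using Iw A types_iff by blast
      then have pK: "p \<in> K" using less unfolding id_less by blast
      have "\<exists>x\<in>A. x \<noteq> w \<and> I x = K"
      proof (cases "J = K")
        case False
        obtain x where "x \<in> A" "I x = K" using ideal_realised[OF K pK A(2)] by blast
        moreover from this have "x \<noteq> w" using Iw False by metis
        ultimately show ?thesis by blast
      next
        case JK: True
        \<comment> \<open>It suffices to find in \<open>A\<close> a point \<open>b \<noteq> w\<close> whose type belongs to the ideal: a trim
          neighbourhood of \<open>b\<close> that avoids \<open>w\<close> then contains points with ideal \<open>K\<close>.\<close>
        have "\<exists>r\<in>K. \<exists>b\<in>A \<inter> X r. b \<noteq> w"
        proof (cases "\<exists>r\<in>C. K = po_down P r")
          case True
          then obtain r where r: "r \<in> C" "K = po_down P r" by blast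
          then have "r \<triangleleft> r" using less JK unfolding id_less po_irrefl_def by blast
          moreover have "w \<in> X r" using in_X_if_types[OF r(1) wt] Iw JK r(2) by blast
          ultimately obtain b where "b \<in> X r" "b \<in> A" "b \<noteq> w"
            using limit_point[OF r(1,1) _ _ Co_openin[OF ACo] A(3)] by blast
          moreover have "r \<in> K" using r by (simp add: po_down_def)
          ultimately show ?thesis by blast
        next
          case False
          have "A \<inter> X p \<noteq> {}" using Trim_meets A by blast
          then obtain b where b: "b \<in> A" "b \<in> X p" by blast
          then have "b \<noteq> w" using types_of_X[OF A(1) b(2)] Iw JK A(1) False by blast
          then show ?thesis using pK b by blast
        qed
        then obtain r b where b: "r \<in> K" "b \<in> A" "b \<in> X r" "b \<noteq> w" by blast
        have rC: "r \<in> C" using b(1) KC by blast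
        have "b \<in> A - {w}" using b by blast
        then obtain B where B: "B \<in> Tr r" "B \<subseteq> A - {w}"
          using trim_base_typed[OF rC b(3) Co_remove_point[OF ACo]] by blast
        then show ?thesis using ideal_realised[OF K b(1) B(1)] by blast
      qed
      then obtain x where x: "x \<in> A" "x \<noteq> w" "I x = K" by blast
      then have "x \<in> XI K" using Co_subset_topspace[OF ACo] XI_iff by blast
      then show "\<exists>y. y \<noteq> w \<and> y \<in> XI K \<and> y \<in> U" using x A(4) by blast
    qed
  }
qed

theorem id_partition: "po_partition W IP XI"
  unfolding po_partition_def
proof (intro conjI ballI)
  show "po_system IP"
    unfolding po_system_def id_less by (auto simp: antisymp_on_def transp_on_def)
  show "XI J \<noteq> {}" "XI J \<subseteq> topspace W" if "J \<in> po_carrier IP" for J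
    using XI_nonempty that by (auto simp: id_carrier XI_iff)
  show "disjoint_family_on XI (po_carrier IP)"
    unfolding disjoint_family_on_def using XI_iff by blast
  fix K assume K: "K \<in> po_carrier IP"
  have *: "\<exists>J. po_ideal P J \<and> w \<in> XI J" if "w \<in> topspace W" for w
    using types_ideal[OF that] that XI_iff by blast
  show "(W derived_set_of XI K) \<inter> family_union IP XI = (\<Union>J\<in>{J \<in> po_carrier IP. po_less IP J K}. XI J)"
  proof (intro equalityI subsetI)
    fix w assume w: "w \<in> (W derived_set_of XI K) \<inter> family_union IP XI"
    then obtain J where "po_ideal P J" "w \<in> XI J"
      unfolding family_union_def by (auto simp: id_carrier)
    then show "w \<in> (\<Union>J\<in>{J \<in> po_carrier IP. po_less IP J K}. XI J)"
      using XI_limit_iff[of J K w] K w id_carrier by blast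
  next
    fix w assume "w \<in> (\<Union>J\<in>{J \<in> po_carrier IP. po_less IP J K}. XI J)"
    then obtain J where "po_ideal P J" "po_less IP J K" "w \<in> XI J"
      using id_carrier by blast
    then show "w \<in> (W derived_set_of XI K) \<inter> family_union IP XI"
      using XI_limit_iff[of J K w] K id_carrier unfolding family_union_def by blast
  qed
qed

text \<open>
  A \<open>p\<close>-trim set contains points with ideal \<open>J\<close> precisely when \<open>p \<in> J\<close>, by \<open>ideal_realised\<close>, and its points
  whose ideal is generated by \<open>p\<close> are those of type \<open>p\<close>.
\<close>

lemma Trim_id:
  assumes p: "p \<in> C" and A: "A \<in> Tr p"
  shows "A \<in> Trim W IP XI (po_down P p)"
proof -
  have "A \<inter> XI J \<noteq> {} \<longleftrightarrow> po_down P p \<subseteq> J" if J: "po_ideal P J" for J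
  proof -
    have "A \<inter> XI J \<noteq> {} \<longleftrightarrow> p \<in> J"
    proof
      assume "A \<inter> XI J \<noteq> {}"
      then obtain x where "x \<in> A" "I x = J" using XI_iff by blast
      then show "p \<in> J" using p A types_iff by blast
    next
      assume "p \<in> J"
      then obtain x where "x \<in> A" "I x = J" using ideal_realised J A by blast
      then show "A \<inter> XI J \<noteq> {}" using XI_iff Co_subset_topspace[OF Trim_Co[OF A]] by blast
    qed
    then show ?thesis using down_subset_ideal J p by blast
  qed
  then have "type_set IP XI A = po_up IP (po_down P p)"
    unfolding type_set_def po_up_def id_leq using id_carrier by blast
  moreover have "card (A \<inter> XI (po_down P p)) = 1" if irr: "po_down P p \<in> po_irrefl IP"
  proof -
    obtain q where "q \<in> C" "\<not> q \<triangleleft> q" "po_down P p = po_down P q"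
      using irr unfolding po_irrefl_def id_less by blast
    then have "\<not> p \<triangleleft> p" using down_inj[OF p] by blast
    then show ?thesis using Trim_card[OF A p] XI_down[OF p] by simp
  qed
  ultimately show ?thesis using Trim_Co[OF A] unfolding Trim_def by blast
qed

theorem id_T1: "T1_condition W IP XI"
  unfolding T1_condition_def neighbourhood_base_at_def
proof (intro ballI allI impI)
  fix w V assume "openin W V \<and> w \<in> V"
  then obtain p A where A: "p \<in> C" "A \<in> Tr p" "w \<in> A" "A \<subseteq> V"
    using trim_base[of V w] by blast
  have "trim_set W IP XI A"
    using Trim_id[OF A(1,2)] down_ideal[OF A(1)] unfolding trim_set_def id_carrier[symmetric] by blast
  then show "\<exists>U B. openin W U \<and> trim_set W IP XI B \<and> w \<in> U \<and> U \<subseteq> B \<and> B \<subseteq> V"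
    using A Co_openin[OF Trim_Co[OF A(2)]] by (intro exI[of _ A]) simp
qed

end

section \<open>Isomorphism of principal rings\<close>

context omega_stone
begin

abbreviation isomorphic (infix \<open>\<asymp>\<close> 50)
  where "A \<asymp> B \<equiv> principal_ring W A \<simeq> principal_ring W B"

abbreviation "K \<equiv> iso_class W"
abbreviation "PI \<equiv> pseudo_indecomposable W"

lemma principal_ring_sel [simp]:
  "carrier (principal_ring W A) = {C \<in> Co W. C \<subseteq> A}"
  "C \<otimes>\<^bsub>principal_ring W A\<^esub> D = C \<inter> D" "\<one>\<^bsub>principal_ring W A\<^esub> = A"
  "\<zero>\<^bsub>principal_ring W A\<^esub> = {}" "C \<oplus>\<^bsub>principal_ring W A\<^esub> D = (C - D) \<union> (D - C)"
  by (simp_all add: principal_ring_def)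

lemma RDirProd_sel [simp]:
  "carrier (RDirProd R S) = carrier R \<times> carrier S"
  "(a, b) \<otimes>\<^bsub>RDirProd R S\<^esub> (c, d) = (a \<otimes>\<^bsub>R\<^esub> c, b \<otimes>\<^bsub>S\<^esub> d)"
  "(a, b) \<oplus>\<^bsub>RDirProd R S\<^esub> (c, d) = (a \<oplus>\<^bsub>R\<^esub> c, b \<oplus>\<^bsub>S\<^esub> d)"
  "\<one>\<^bsub>RDirProd R S\<^esub> = (\<one>\<^bsub>R\<^esub>, \<one>\<^bsub>S\<^esub>)"
  by (simp_all add: RDirProd_def DirProd_def monoid.defs)

lemma ring_principal_ring:
  assumes A: "A \<in> Co W"
  shows "ring (principal_ring W A)"
proof (rule ringI)
  show "abelian_group (principal_ring W A)"
  proof (rule abelian_groupI)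
    fix C assume C: "C \<in> carrier (principal_ring W A)"
    then have "C \<oplus>\<^bsub>principal_ring W A\<^esub> C = \<zero>\<^bsub>principal_ring W A\<^esub>" by simp
    with C show "\<exists>D\<in>carrier (principal_ring W A). D \<oplus>\<^bsub>principal_ring W A\<^esub> C = \<zero>\<^bsub>principal_ring W A\<^esub>"
      by blast
  qed auto
  show "Group.monoid (principal_ring W A)"
    by (rule monoidI) (use A in auto)
qed auto

lemma iso_sym: "\<lbrakk>A \<in> Co W; A \<asymp> B\<rbrakk> \<Longrightarrow> B \<asymp> A"
  using ring_iso_sym ring_principal_ring by blast

lemma iso_class_eq_iff:
  assumes "A \<in> Co W" "B \<in> Co W"
  shows "K A = K B \<longleftrightarrow> A \<asymp> B"
proof
  assume "K A = K B"
  moreover have "A \<in> K A" using assms by (simp add: iso_class_def ring_iso_refl)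
  ultimately show "A \<asymp> B" by (simp add: iso_class_def)
next
  assume "A \<asymp> B"
  then show "K A = K B"
    unfolding iso_class_def using iso_sym assms ring_iso_trans by blast
qed

lemma iso_empty:
  assumes f: "f \<in> ring_iso (principal_ring W A) (principal_ring W B)"
  shows "f {} = {}"
  using ring_iso_memE(3)[OF f, of "{}" "{}"] by simp

lemma iso_subset_iff:
  assumes f: "f \<in> ring_iso (principal_ring W A) (principal_ring W B)"
    and CD: "C \<in> Co W" "C \<subseteq> A" "D \<in> Co W" "D \<subseteq> A"
  shows "f C \<subseteq> f D \<longleftrightarrow> C \<subseteq> D"
proof -
  have "f (C \<inter> D) = f C \<inter> f D" using ring_iso_memE(2)[OF f, of C D] CD by simp
  then have "f C \<subseteq> f D \<longleftrightarrow> f (C \<inter> D) = f C" by blast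
  also have "\<dots> \<longleftrightarrow> C \<inter> D = C"
    using bij_betw_imp_inj_on[OF ring_iso_memE(5)[OF f]] CD Co_Int
    by (intro inj_on_eq_iff[where A = "{C \<in> Co W. C \<subseteq> A}"]) auto
  finally show ?thesis by blast
qed

text \<open>
  The order of \<open>(A)\<close> is determined by its multiplication, so that \<open>f\<close> carries the sets below \<open>C\<close> to those
  below \<open>f C\<close>.
\<close>

lemma iso_restrict:
  assumes f: "f \<in> ring_iso (principal_ring W A) (principal_ring W B)"
    and C: "C \<in> Co W" "C \<subseteq> A"
  shows "f \<in> ring_iso (principal_ring W C) (principal_ring W (f C))"
proof (rule ring_iso_memI)
  have bij: "bij_betw f {D \<in> Co W. D \<subseteq> A} {D \<in> Co W. D \<subseteq> B}"
    using ring_iso_memE(5)[OF f] by simp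
  have fC: "f C \<in> Co W" "f C \<subseteq> B" using ring_iso_memE(1)[OF f, of C] C by auto
  have in_fC: "f D \<in> Co W \<and> f D \<subseteq> f C" if "D \<in> Co W" "D \<subseteq> C" for D
    using ring_iso_memE(1)[OF f, of D] iso_subset_iff[OF f, of D C] that C by auto
  then show "\<And>D. D \<in> carrier (principal_ring W C) \<Longrightarrow> f D \<in> carrier (principal_ring W (f C))"
    by simp
  have "f ` {D \<in> Co W. D \<subseteq> C} = {D \<in> Co W. D \<subseteq> f C}"
  proof (intro equalityI subsetI)
    fix D assume D: "D \<in> {D \<in> Co W. D \<subseteq> f C}"
    then have "D \<in> f ` {D \<in> Co W. D \<subseteq> A}" using bij_betw_imp_surj_on[OF bij] fC by auto
    then obtain E where E: "E \<in> Co W" "E \<subseteq> A" "D = f E" by blast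
    then have "E \<subseteq> C" using iso_subset_iff[OF f E(1,2) C] D by simp
    then show "D \<in> f ` {D \<in> Co W. D \<subseteq> C}" using E by blast
  qed (use in_fC in auto)
  moreover have "inj_on f {D \<in> Co W. D \<subseteq> C}"
    using bij_betw_imp_inj_on[OF bij] by (rule inj_on_subset) (use C(2) in auto)
  ultimately show "bij_betw f (carrier (principal_ring W C)) (carrier (principal_ring W (f C)))"
    by (simp add: bij_betw_def)
next
  fix D E assume "D \<in> carrier (principal_ring W C)" "E \<in> carrier (principal_ring W C)"
  then show "f (D \<otimes>\<^bsub>principal_ring W C\<^esub> E) = f D \<otimes>\<^bsub>principal_ring W (f C)\<^esub> f E"
    "f (D \<oplus>\<^bsub>principal_ring W C\<^esub> E) = f D \<oplus>\<^bsub>principal_ring W (f C)\<^esub> f E"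
    using ring_iso_memE(2,3)[OF f, of D E] C by auto
qed simp

lemma iso_split:
  assumes AB: "A \<asymp> B" and A: "A \<in> Co W" and C: "C \<in> Co W" "C \<subseteq> A"
  shows "\<exists>D\<in>Co W. D \<subseteq> B \<and> C \<asymp> D \<and> A - C \<asymp> B - D"
proof -
  obtain f where f: "f \<in> ring_iso (principal_ring W A) (principal_ring W B)"
    using AB unfolding is_ring_iso_def by blast
  have "f A = B" using ring_iso_memE(4)[OF f] by simp
  have "f (A - C) = B - f C"
  proof -
    have "A - C = (A - C) \<union> (C - A)" using C by blast
    moreover have "f ((A - C) \<union> (C - A)) = (f A - f C) \<union> (f C - f A)"
      using ring_iso_memE(3)[OF f, of A C] A C by simp
    moreover have "f C \<subseteq> f A" using iso_subset_iff[OF f C A] C by simp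
    ultimately show ?thesis using \<open>f A = B\<close> by auto
  qed
  moreover have "C \<asymp> f C" "A - C \<asymp> f (A - C)"
    using iso_restrict[OF f] C A unfolding is_ring_iso_def by blast+
  moreover have "f C \<in> Co W" "f C \<subseteq> B" using ring_iso_memE(1)[OF f, of C] C by auto
  ultimately show ?thesis by auto
qed

lemma iso_nonempty:
  assumes AB: "A \<asymp> B" and A: "A \<in> Co W" "A \<noteq> {}"
  shows "B \<noteq> {}"
proof -
  obtain f where f: "f \<in> ring_iso (principal_ring W A) (principal_ring W B)"
    using AB unfolding is_ring_iso_def by blast
  then have "f A = B" "f {} = {}" using ring_iso_memE(4)[OF f] iso_empty by auto
  moreover have "f A \<subseteq> f {} \<longleftrightarrow> A \<subseteq> {}" using iso_subset_iff[OF f A(1), of "{}"] by simp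
  ultimately show ?thesis using A by blast
qed

lemma iso_product_of_split:
  assumes A: "A \<in> Co W" and B: "B \<in> Co W" "B \<subseteq> A"
  shows "RDirProd (principal_ring W B) (principal_ring W (A - B)) \<simeq> principal_ring W A"
proof -
  let ?f = "\<lambda>(C, D). C \<union> D :: 'w set"
  have "?f \<in> ring_iso (RDirProd (principal_ring W B) (principal_ring W (A - B))) (principal_ring W A)"
  proof (rule ring_iso_memI)
    show "?f \<one>\<^bsub>RDirProd (principal_ring W B) (principal_ring W (A - B))\<^esub> = \<one>\<^bsub>principal_ring W A\<^esub>"
      using B by auto
    have "inj_on ?f ({C \<in> Co W. C \<subseteq> B} \<times> {C \<in> Co W. C \<subseteq> A - B})"
      by (rule inj_onI) auto
    moreover have "?f ` ({C \<in> Co W. C \<subseteq> B} \<times> {C \<in> Co W. C \<subseteq> A - B}) = {C \<in> Co W. C \<subseteq> A}"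
    proof (intro equalityI subsetI)
      fix C assume C: "C \<in> {C \<in> Co W. C \<subseteq> A}"
      then have "C = ?f (C \<inter> B, C - B)" by auto
      moreover have "(C \<inter> B, C - B) \<in> {C \<in> Co W. C \<subseteq> B} \<times> {C \<in> Co W. C \<subseteq> A - B}"
        using C B by auto
      ultimately show "C \<in> ?f ` ({C \<in> Co W. C \<subseteq> B} \<times> {C \<in> Co W. C \<subseteq> A - B})" by blast
    qed (use B in auto)
    ultimately show "bij_betw ?f (carrier (RDirProd (principal_ring W B) (principal_ring W (A - B))))
        (carrier (principal_ring W A))"
      by (simp add: bij_betw_def)
  next
    fix x y
    assume "x \<in> carrier (RDirProd (principal_ring W B) (principal_ring W (A - B)))"
      and "y \<in> carrier (RDirProd (principal_ring W B) (principal_ring W (A - B)))"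
    then obtain C D C' D' where xy: "x = (C, D)" "y = (C', D')" "C \<subseteq> B" "C' \<subseteq> B" "D \<subseteq> A - B" "D' \<subseteq> A - B"
      by auto
    then show "?f (x \<otimes>\<^bsub>RDirProd (principal_ring W B) (principal_ring W (A - B))\<^esub> y)
          = ?f x \<otimes>\<^bsub>principal_ring W A\<^esub> ?f y"
      "?f (x \<oplus>\<^bsub>RDirProd (principal_ring W B) (principal_ring W (A - B))\<^esub> y)
          = ?f x \<oplus>\<^bsub>principal_ring W A\<^esub> ?f y"
      by auto
  qed (use B in auto)
  then show ?thesis unfolding is_ring_iso_def by blast
qed

text \<open>
  The image of the idempotent \<open>(1, 0)\<close> cuts a copy of the first factor out of \<open>E\<close>.
\<close>

lemma iso_first_factor:
  assumes A: "A \<in> Co W"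
    and g: "g \<in> ring_iso (RDirProd (principal_ring W A) (principal_ring W B)) (principal_ring W E)"
  shows "g (A, {}) \<in> Co W" "g (A, {}) \<subseteq> E" "A \<asymp> g (A, {})"
proof -
  let ?R = "RDirProd (principal_ring W A) (principal_ring W B)"
  define D where "D = g (A, {})"
  have g_in: "g (C, {}) \<in> Co W \<and> g (C, {}) \<subseteq> E" if "C \<in> Co W" "C \<subseteq> A" for C
    using ring_iso_memE(1)[OF g, of "(C, {})"] that by simp
  then show "g (A, {}) \<in> Co W" "g (A, {}) \<subseteq> E" using A by auto
  then have D: "D \<in> Co W" "D \<subseteq> E" by (auto simp: D_def)
  have inj: "inj_on g (carrier ?R)" and surj: "g ` carrier ?R = {C \<in> Co W. C \<subseteq> E}"
    using ring_iso_memE(5)[OF g] by (auto simp: bij_betw_def)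
  have g_Int_D: "g (C, C') \<inter> D = g (C, {})"
    if "C \<in> Co W" "C \<subseteq> A" "C' \<in> Co W" "C' \<subseteq> B" for C C'
  proof -
    have "g (C \<inter> A, C' \<inter> {}) = g (C, C') \<inter> D"
      using ring_iso_memE(2)[OF g, of "(C, C')" "(A, {})"] that A by (simp add: D_def)
    moreover have "C \<inter> A = C" using that by blast
    ultimately show ?thesis by simp
  qed
  have "(\<lambda>C. g (C, {})) \<in> ring_iso (principal_ring W A) (principal_ring W D)"
  proof (rule ring_iso_memI)
    have sub: "g (C, {}) \<in> Co W \<and> g (C, {}) \<subseteq> D" if "C \<in> Co W" "C \<subseteq> A" for C
      using g_in[OF that] g_Int_D[OF that, of "{}"] by auto
    then show "\<And>C. C \<in> carrier (principal_ring W A) \<Longrightarrow> g (C, {}) \<in> carrier (principal_ring W D)" by simp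
    have "inj_on (\<lambda>C. g (C, {})) {C \<in> Co W. C \<subseteq> A}"
    proof (rule inj_onI)
      fix C C' assume C: "C \<in> {C \<in> Co W. C \<subseteq> A}" "C' \<in> {C \<in> Co W. C \<subseteq> A}" "g (C, {}) = g (C', {})"
      have "(C, {}) = (C', {} :: 'w set)" using C(1,2) by (intro inj_onD[OF inj C(3)]) auto
      then show "C = C'" by simp
    qed
    moreover have "(\<lambda>C. g (C, {})) ` {C \<in> Co W. C \<subseteq> A} = {C \<in> Co W. C \<subseteq> D}"
    proof (intro equalityI subsetI)
      fix Y assume Y: "Y \<in> {C \<in> Co W. C \<subseteq> D}"
      then have "Y \<in> g ` carrier ?R" unfolding surj using D by blast
      then obtain C C' where C: "C \<in> Co W" "C \<subseteq> A" "C' \<in> Co W" "C' \<subseteq> B" "Y = g (C, C')" by auto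
      have "Y = g (C, {})" using g_Int_D[OF C(1-4)] C(5) Y by auto
      then show "Y \<in> (\<lambda>C. g (C, {})) ` {C \<in> Co W. C \<subseteq> A}" using C by blast
    qed (use sub in auto)
    ultimately show "bij_betw (\<lambda>C. g (C, {})) (carrier (principal_ring W A)) (carrier (principal_ring W D))"
      by (simp add: bij_betw_def)
  next
    fix C C' assume C: "C \<in> carrier (principal_ring W A)" "C' \<in> carrier (principal_ring W A)"
    show "g (C \<otimes>\<^bsub>principal_ring W A\<^esub> C', {}) = g (C, {}) \<otimes>\<^bsub>principal_ring W D\<^esub> g (C', {})"
      using ring_iso_memE(2)[OF g, of "(C, {})" "(C', {})"] C by simp
    show "g (C \<oplus>\<^bsub>principal_ring W A\<^esub> C', {}) = g (C, {}) \<oplus>\<^bsub>principal_ring W D\<^esub> g (C', {})"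
      using ring_iso_memE(3)[OF g, of "(C, {})" "(C', {})"] C by simp
  qed (simp add: D_def)
  then show "A \<asymp> g (A, {})" unfolding is_ring_iso_def D_def by blast
qed

lemma split_of_iso_product:
  assumes A: "A \<in> Co W" and B: "B \<in> Co W"
    and iso: "RDirProd (principal_ring W A) (principal_ring W B) \<simeq> principal_ring W E"
  shows "\<exists>D\<in>Co W. D \<subseteq> E \<and> A \<asymp> D \<and> B \<asymp> E - D"
proof -
  obtain g where g: "g \<in> ring_iso (RDirProd (principal_ring W A) (principal_ring W B)) (principal_ring W E)"
    using iso unfolding is_ring_iso_def by blast
  note g' = ring_iso_set_trans[OF RDirProd_iso1 g]
  have "g ({}, {}) = {}" using ring_iso_memE(3)[OF g, of "({}, {})" "({}, {})"] by simp
  then have "g (A, {}) \<inter> g ({}, B) = {}"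
    using ring_iso_memE(2)[OF g, of "(A, {})" "({}, B)"] A B by simp
  moreover have "E = (g (A, {}) - g ({}, B)) \<union> (g ({}, B) - g (A, {}))"
    using ring_iso_memE(3)[OF g, of "(A, {})" "({}, B)"] ring_iso_memE(4)[OF g] A B by simp
  ultimately have "E - g (A, {}) = g ({}, B)" by blast
  moreover have "B \<asymp> g ({}, B)" using iso_first_factor(3)[OF B g'] by simp
  ultimately show ?thesis using iso_first_factor[OF A g] by auto
qed

lemma homeomorphic_image_Co:
  assumes h: "homeomorphic_map (subtopology W A) (subtopology W B) h"
    and A: "A \<in> Co W" and B: "B \<in> Co W" and C: "C \<in> Co W" "C \<subseteq> A"
  shows "h ` C \<in> Co W \<and> h ` C \<subseteq> B"
proof -
  have op: "openin (subtopology W A) C"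
    using openin_open_subtopology[OF Co_openin[OF A]] Co_openin[OF C(1)] C(2) by simp
  have comp: "compactin (subtopology W A) C"
    using compactin_subtopology Co_compactin[OF C(1)] C(2) by blast
  have "openin (subtopology W B) (h ` C)"
    using homeomorphic_map_openness[OF h openin_subset[OF op]] op by simp
  moreover have "compactin (subtopology W B) (h ` C)"
    by (rule image_compactin[OF comp homeomorphic_imp_continuous_map[OF h]])
  ultimately show ?thesis
    using openin_open_subtopology[OF Co_openin[OF B]] by (simp add: Co_def compactin_subtopology)
qed

lemma homeomorphic_imp_iso:
  assumes h: "homeomorphic_map (subtopology W A) (subtopology W B) h"
    and A: "A \<in> Co W" and B: "B \<in> Co W"
  shows "A \<asymp> B"
proof -
  have topA: "topspace (subtopology W A) = A" and topB: "topspace (subtopology W B) = B"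
    using Co_subset_topspace A B by auto
  obtain k where hk: "homeomorphic_maps (subtopology W A) (subtopology W B) h k"
    using h homeomorphic_map_maps by blast
  then have "homeomorphic_maps (subtopology W B) (subtopology W A) k h"
    using homeomorphic_maps_sym by blast
  then have k: "homeomorphic_map (subtopology W B) (subtopology W A) k"
    by (rule homeomorphic_maps_imp_map)
  have hk': "\<And>x. x \<in> B \<Longrightarrow> h (k x) = x"
    using hk topB unfolding homeomorphic_maps_def by blast
  have inj: "inj_on h A" and im: "h ` A = B"
    using homeomorphic_imp_injective_map[OF h] homeomorphic_imp_surjective_map[OF h] topA topB by auto
  have "(\<lambda>C. h ` C) \<in> ring_iso (principal_ring W A) (principal_ring W B)"
  proof (rule ring_iso_memI)
    show "\<And>C. C \<in> carrier (principal_ring W A) \<Longrightarrow> h ` C \<in> carrier (principal_ring W B)"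
      using homeomorphic_image_Co[OF h A B] by simp
    have "inj_on (\<lambda>C. h ` C) {C \<in> Co W. C \<subseteq> A}"
      by (rule inj_onI) (use inj_on_image_eq_iff[OF inj] in blast)
    moreover have "(\<lambda>C. h ` C) ` {C \<in> Co W. C \<subseteq> A} = {C \<in> Co W. C \<subseteq> B}"
    proof (intro equalityI subsetI)
      fix D assume D: "D \<in> {C \<in> Co W. C \<subseteq> B}"
      then have "k ` D \<in> Co W \<and> k ` D \<subseteq> A" using homeomorphic_image_Co[OF k B A] by simp
      moreover have "D = h ` (k ` D)" using D hk' by (force simp: image_iff)
      ultimately show "D \<in> (\<lambda>C. h ` C) ` {C \<in> Co W. C \<subseteq> A}" by blast
    qed (use homeomorphic_image_Co[OF h A B] in auto)
    ultimately show "bij_betw (\<lambda>C. h ` C) (carrier (principal_ring W A)) (carrier (principal_ring W B))"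
      by (simp add: bij_betw_def)
  next
    fix C D assume CD: "C \<in> carrier (principal_ring W A)" "D \<in> carrier (principal_ring W A)"
    then show "h ` (C \<otimes>\<^bsub>principal_ring W A\<^esub> D) = h ` C \<otimes>\<^bsub>principal_ring W B\<^esub> h ` D"
      using inj_on_image_Int[OF inj, of C D] by simp
    have "h ` (C - D) = h ` C - h ` D" "h ` (D - C) = h ` D - h ` C"
      using CD by (auto intro!: inj_on_image_set_diff[OF inj])
    then show "h ` (C \<oplus>\<^bsub>principal_ring W A\<^esub> D) = h ` C \<oplus>\<^bsub>principal_ring W B\<^esub> h ` D"
      by (simp add: image_Un)
  qed (simp add: im)
  then show ?thesis unfolding is_ring_iso_def by blast
qed

lemma homeomorphism_iso_class:
  assumes g: "homeomorphic_map W W g" and A: "A \<in> Co W"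
  shows "g ` A \<in> Co W" "K (g ` A) = K A"
proof -
  have sub: "A \<subseteq> topspace W" using Co_subset_topspace A by blast
  show gA: "g ` A \<in> Co W"
    using homeomorphic_map_openness[OF g sub] image_compactin[OF Co_compactin[OF A]]
      homeomorphic_imp_continuous_map[OF g] Co_openin[OF A] by (auto simp: Co_def)
  have "homeomorphic_map (subtopology W A) (subtopology W (g ` A)) g"
    using Co_subset_topspace[OF gA] sub
    by (intro homeomorphic_map_subtopologies[OF g]) (auto simp: Int_absorb1)
  then have "A \<asymp> g ` A" using homeomorphic_imp_iso A gA by blast
  then show "K (g ` A) = K A" using iso_class_eq_iff A gA by metis
qed

end

section \<open>The canonical partition\<close>

locale primitive_omega = omega_stone W for W :: "'w topology" +
  assumes primitive: "primitive_space W"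
begin

abbreviation "S \<equiv> po_carrier (PI_system W)"
abbreviation "XC \<equiv> canonical_partition W"

lemma PI_Co: "PI A \<Longrightarrow> A \<in> Co W"
  by (simp add: pseudo_indecomposable_def)

lemma S_iff: "p \<in> S \<longleftrightarrow> (\<exists>A. PI A \<and> p = K A)"
  by (auto simp: PI_system_def)

lemma PI_iso:
  assumes A: "PI A" and AB: "A \<asymp> B" and B: "B \<in> Co W"
  shows "PI B"
  unfolding pseudo_indecomposable_def
proof (intro conjI ballI impI)
  have ACo: "A \<in> Co W" and "A \<noteq> {}" using A by (auto simp: pseudo_indecomposable_def)
  then show "B \<noteq> {}" using iso_nonempty AB by blast
  fix D assume D: "D \<in> Co W" "D \<subseteq> B"
  obtain C where C: "C \<in> Co W" "C \<subseteq> A" "D \<asymp> C" "B - D \<asymp> A - C"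
    using iso_split[OF iso_sym[OF ACo AB] B D] by blast
  have "C \<asymp> A \<or> A - C \<asymp> A" using A C(1,2) unfolding pseudo_indecomposable_def by blast
  then show "D \<asymp> B \<or> B - D \<asymp> B"
    using C(3,4) AB ring_iso_trans by blast
qed (rule B)

lemma PI_if_class: "\<lbrakk>A \<in> Co W; K A \<in> S\<rbrakk> \<Longrightarrow> PI A"
  using S_iff PI_iso PI_Co iso_class_eq_iff by metis

lemma class_nonempty: "\<lbrakk>A \<in> Co W; K A \<in> S\<rbrakk> \<Longrightarrow> A \<noteq> {}"
  using PI_if_class unfolding pseudo_indecomposable_def by blast

lemma class_transport:
  assumes "K A = K B" "A \<in> Co W" "B \<in> Co W" "C \<in> Co W" "C \<subseteq> A"
  shows "\<exists>D\<in>Co W. D \<subseteq> B \<and> K D = K C \<and> K (B - D) = K (A - C)"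
proof -
  obtain D where D: "D \<in> Co W" "D \<subseteq> B" "C \<asymp> D" "A - C \<asymp> B - D"
    using iso_split[of A B C] assms iso_class_eq_iff by blast
  then have "K C = K D" "K (A - C) = K (B - D)"
    using iso_class_eq_iff assms Co_Diff by blast+
  then show ?thesis using D by auto
qed

text \<open>
  If \<open>A\<close> contains disjoint copies of \<open>A\<close> and \<open>B\<close>, and \<open>[A] \<noteq> [B]\<close>, then \<open>(A) \<times> (B) \<cong> (A)\<close> by
  pseudo-indecomposability.  For \<open>[A] = [B]\<close> this is true as well but needs the uniqueness of trim
  sets.  The relation in terms of copies is therefore used first: for it, limit points and the
  number of points of a given type in a set are immediate.
\<close>

definition embeds :: "'w set set \<Rightarrow> 'w set set \<Rightarrow> bool" where
  "embeds p q \<longleftrightarrow> p \<in> S \<and> q \<in> S \<and>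
     (\<exists>A\<in>Co W. \<exists>B\<in>Co W. \<exists>C\<in>Co W. B \<subseteq> A \<and> C \<subseteq> A \<and> B \<inter> C = {} \<and> K A = p \<and> K B = p \<and> K C = q)"

definition embedding_system :: "'w set set po_sys" where
  "embedding_system = \<lparr>po_carrier = S, po_less = embeds\<rparr>"

abbreviation leq_e (infix \<open>\<unlhd>\<^sub>e\<close> 50)
  where "leq_e \<equiv> po_leq embedding_system"

lemma leq_e_iff: "p \<unlhd>\<^sub>e q \<longleftrightarrow> embeds p q \<or> p = q"
  by (simp add: po_leq_def embedding_system_def)

lemma embeds_in:
  assumes "embeds p q" "A \<in> Co W" "K A = p"
  shows "\<exists>B\<in>Co W. \<exists>C\<in>Co W. B \<subseteq> A \<and> C \<subseteq> A \<and> B \<inter> C = {} \<and> K B = p \<and> K C = q"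
proof -
  obtain A' B' C' where 1: "A' \<in> Co W" "B' \<in> Co W" "C' \<in> Co W" "B' \<subseteq> A'" "C' \<subseteq> A'" "B' \<inter> C' = {}"
    "K A' = p" "K B' = p" "K C' = q"
    using assms(1) unfolding embeds_def by blast
  obtain B where B: "B \<in> Co W" "B \<subseteq> A" "K B = K B'" "K (A - B) = K (A' - B')"
    using class_transport[of A' A B'] 1 assms by auto
  have "C' \<subseteq> A' - B'" "A' - B' \<in> Co W" "A - B \<in> Co W" using 1 B(1) assms(2) by auto
  then obtain C where "C \<in> Co W" "C \<subseteq> A - B" "K C = K C'"
    using class_transport[of "A' - B'" "A - B" C'] 1(3) B(4) by auto
  then show ?thesis using B 1(8,9) by (intro bexI[of _ B] bexI[of _ C]) auto
qed

text \<open>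
  If \<open>B\<close> is not a copy of \<open>A\<close>, then \<open>A - B\<close> is one, by pseudo-indecomposability of \<open>A\<close>.
\<close>

lemma subset_leq_e:
  assumes A: "A \<in> Co W" "K A \<in> S" and B: "B \<in> Co W" "K B \<in> S" and BA: "B \<subseteq> A"
  shows "K A \<unlhd>\<^sub>e K B"
proof (cases "K A = K B")
  case False
  have "PI A" using PI_if_class A by blast
  moreover have "\<not> B \<asymp> A" using False iso_class_eq_iff A B by metis
  ultimately have "A - B \<asymp> A" using B BA unfolding pseudo_indecomposable_def by blast
  then have "K (A - B) = K A" using iso_class_eq_iff A B Co_Diff by blast
  moreover have "A - B \<in> Co W" using A B by blast
  ultimately have "embeds (K A) (K B)"
    unfolding embeds_def using A B BA
    by (intro conjI bexI[of _ A] bexI[of _ "A - B"] bexI[of _ B]) auto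
  then show ?thesis by (simp add: leq_e_iff)
qed (simp add: leq_e_iff)

lemma leq_e_subset:
  assumes "p \<unlhd>\<^sub>e q" "A \<in> Co W" "K A = p"
  shows "\<exists>B\<in>Co W. B \<subseteq> A \<and> K B = q"
  using assms embeds_in[of p q A] unfolding leq_e_iff by blast

lemma PI_less_iff:
  assumes A: "PI A" and B: "PI B"
  shows "po_less (PI_system W) (K A) (K B) \<longleftrightarrow> (\<exists>D\<in>Co W. D \<subseteq> A \<and> K D = K A \<and> K (A - D) = K B)"
proof
  assume "po_less (PI_system W) (K A) (K B)"
  then obtain A' B' where 1: "PI A'" "PI B'" "K A = K A'" "K B = K B'"
    "RDirProd (principal_ring W A') (principal_ring W B') \<simeq> principal_ring W A'"
    unfolding PI_system_def by auto
  obtain D where D: "D \<in> Co W" "D \<subseteq> A'" "A' \<asymp> D" "B' \<asymp> A' - D"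
    using split_of_iso_product[OF PI_Co[OF 1(1)] PI_Co[OF 1(2)] 1(5)] by blast
  then have KD: "K D = K A'" "K (A' - D) = K B'"
    using iso_class_eq_iff PI_Co[OF 1(1)] PI_Co[OF 1(2)] Co_Diff by metis+
  obtain E where "E \<in> Co W" "E \<subseteq> A" "K E = K D" "K (A - E) = K (A' - D)"
    using class_transport[of A' A D] 1(3) PI_Co[OF A] PI_Co[OF 1(1)] D by auto
  then show "\<exists>D\<in>Co W. D \<subseteq> A \<and> K D = K A \<and> K (A - D) = K B" using KD 1(3,4) by auto
next
  assume "\<exists>D\<in>Co W. D \<subseteq> A \<and> K D = K A \<and> K (A - D) = K B"
  then obtain D where D: "D \<in> Co W" "D \<subseteq> A" "K D = K A" "K (A - D) = K B" by blast
  have "A \<asymp> D" "B \<asymp> A - D"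
    using iso_class_eq_iff D PI_Co[OF A] PI_Co[OF B] Co_Diff by metis+
  then obtain f g where "f \<in> ring_iso (principal_ring W A) (principal_ring W D)"
    and "g \<in> ring_iso (principal_ring W B) (principal_ring W (A - D))"
    unfolding is_ring_iso_def by blast
  then have "RDirProd (principal_ring W A) (principal_ring W B)
      \<simeq> RDirProd (principal_ring W D) (principal_ring W (A - D))"
    using RDirProd_iso6 unfolding is_ring_iso_def by blast
  then have "RDirProd (principal_ring W A) (principal_ring W B) \<simeq> principal_ring W A"
    using ring_iso_trans iso_product_of_split[OF PI_Co[OF A] D(1,2)] by blast
  then show "po_less (PI_system W) (K A) (K B)"
    unfolding PI_system_def using A B by auto
qed

text \<open>
  For different classes each of \<open>A\<close> and \<open>B\<close> absorbs the other, so that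
  \<open>(A) \<cong> (A) \<times> (B) \<cong> (B) \<times> (A) \<cong> (B)\<close>.
\<close>

lemma embeds_antisym:
  assumes pq: "embeds p q" "embeds q p"
  shows "p = q"
proof (rule ccontr)
  note [trans] = ring_iso_trans
  assume ne: "p \<noteq> q"
  obtain A B where A: "PI A" "p = K A" and B: "PI B" "q = K B"
    using pq unfolding embeds_def S_iff by blast
  have ACo: "A \<in> Co W" and BCo: "B \<in> Co W" using PI_Co A B by auto
  have absorb: "RDirProd (principal_ring W E) (principal_ring W F) \<simeq> principal_ring W E"
    if E: "PI E" and F: "F \<in> Co W" and EF: "embeds (K E) (K F)" "K E \<noteq> K F" for E F
  proof -
    have ECo: "E \<in> Co W" using PI_Co E by blast
    obtain C where C: "C \<in> Co W" "C \<subseteq> E" "K C = K F"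
      using embeds_in[OF EF(1) ECo] by blast
    have "\<not> C \<asymp> E" using C EF(2) iso_class_eq_iff ECo by metis
    then have "E - C \<asymp> E" using E C unfolding pseudo_indecomposable_def by blast
    then have EC: "E \<asymp> E - C" using iso_sym ECo C(1) by blast
    have FC: "F \<asymp> C" using C iso_class_eq_iff F by metis
    obtain f g where "f \<in> ring_iso (principal_ring W E) (principal_ring W (E - C))"
      and "g \<in> ring_iso (principal_ring W F) (principal_ring W C)"
      using EC FC unfolding is_ring_iso_def by blast
    then have "RDirProd (principal_ring W E) (principal_ring W F)
        \<simeq> RDirProd (principal_ring W (E - C)) (principal_ring W C)"
      using RDirProd_iso6 unfolding is_ring_iso_def by blast
    also have "RDirProd (principal_ring W (E - C)) (principal_ring W C)
        \<simeq> RDirProd (principal_ring W C) (principal_ring W (E - C))"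
      using RDirProd_iso1 unfolding is_ring_iso_def by blast
    also have "\<dots> \<simeq> principal_ring W E" using iso_product_of_split[OF ECo C(1,2)] .
    finally show ?thesis .
  qed
  have AB: "RDirProd (principal_ring W A) (principal_ring W B) \<simeq> principal_ring W A"
    using absorb[OF A(1) BCo] pq(1) ne A B by simp
  have BA: "RDirProd (principal_ring W B) (principal_ring W A) \<simeq> principal_ring W B"
    using absorb[OF B(1) ACo] pq(2) ne A B by simp
  have "ring (RDirProd (principal_ring W A) (principal_ring W B))"
    using RDirProd_ring ring_principal_ring ACo BCo by blast
  then have "principal_ring W A \<simeq> RDirProd (principal_ring W A) (principal_ring W B)"
    using ring_iso_sym AB by blast
  also have "RDirProd (principal_ring W A) (principal_ring W B)
      \<simeq> RDirProd (principal_ring W B) (principal_ring W A)"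
    using RDirProd_iso1 unfolding is_ring_iso_def by blast
  also have "\<dots> \<simeq> principal_ring W B" by (rule BA)
  finally have "A \<asymp> B" .
  then show False using iso_class_eq_iff ACo BCo A B ne by metis
qed

lemma embeds_trans:
  assumes pq: "embeds p q" and qr: "embeds q r"
  shows "embeds p r"
proof -
  obtain A where A: "A \<in> Co W" "K A = p" using pq unfolding embeds_def by blast
  obtain B C where BC: "B \<in> Co W" "C \<in> Co W" "B \<subseteq> A" "C \<subseteq> A" "B \<inter> C = {}" "K B = p" "K C = q"
    using embeds_in[OF pq A] by blast
  obtain D where D: "D \<in> Co W" "D \<subseteq> C" "K D = r"
    using embeds_in[OF qr BC(2,7)] by blast
  have "p \<in> S" "r \<in> S" using pq qr unfolding embeds_def by blast+
  then show ?thesis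
    unfolding embeds_def using A BC D
    by (intro conjI bexI[of _ A] bexI[of _ B] bexI[of _ D]) auto
qed

lemma XC_iff:
  "w \<in> XC p \<longleftrightarrow> w \<in> topspace W \<and> (\<forall>U. openin W U \<and> w \<in> U \<longrightarrow> (\<exists>A\<in>Co W. K A = p \<and> w \<in> A \<and> A \<subseteq> U))"
proof -
  have "neighbourhood_base_at w (\<lambda>A. A \<in> Co W \<and> K A = p) W \<longleftrightarrow>
      (\<forall>U. openin W U \<and> w \<in> U \<longrightarrow> (\<exists>A. (A \<in> Co W \<and> K A = p) \<and> w \<in> A \<and> A \<subseteq> U))"
    by (rule open_neighbourhood_base_at) (use Co_openin in blast)
  then show ?thesis unfolding canonical_partition_def by blast
qed

lemma XC_nbhd: "\<lbrakk>w \<in> XC p; openin W U; w \<in> U\<rbrakk> \<Longrightarrow> \<exists>A\<in>Co W. K A = p \<and> w \<in> A \<and> A \<subseteq> U"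
  by (simp add: XC_iff)

lemma PI_base:
  assumes "openin W U" "w \<in> U"
  shows "\<exists>A. PI A \<and> w \<in> A \<and> A \<subseteq> U"
proof -
  obtain A where A: "A \<in> Co W" "w \<in> A" "A \<subseteq> U" using Co_base[OF assms] by blast
  obtain F where F: "\<forall>B\<in>F. PI B" "A = \<Union>F"
    using primitive A(1) unfolding primitive_space_def by meson
  obtain B where "B \<in> F" "w \<in> B" using A(2) F(2) by blast
  then have "PI B \<and> w \<in> B \<and> B \<subseteq> U" using F A(3) by auto
  then show ?thesis ..
qed

text \<open>
  Whenever \<open>A\<close> is cut in two, one of the halves is a copy of \<open>A\<close>; these halves can be made to shrink
  to a point.
\<close>

lemma class_point:
  assumes A: "A \<in> Co W" "K A \<in> S"
  shows "\<exists>w\<in>A. w \<in> XC (K A)"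
proof -
  define Q where "Q = (\<lambda>(n::nat) B. B \<in> Co W \<and> K B = K A)"
  have "\<exists>w H. (\<forall>n. Q n (H n) \<and> w \<in> H n \<and> H n \<subseteq> A) \<and>
      (\<forall>U. openin W U \<and> w \<in> U \<longrightarrow> (\<exists>n. H n \<subseteq> U))"
  proof (rule shrinking_sets[of Q A])
    show "Q 0 A" using A by (simp add: Q_def)
    show "B \<in> Co W" if "Q n B" for n B using that by (simp add: Q_def)
    show "B \<noteq> {}" if "Q n B" for n B using that class_nonempty[of B] A by (simp add: Q_def)
    show "\<exists>H\<subseteq>B. Q (Suc n) H \<and> (H \<subseteq> D \<or> H \<inter> D = {})" if Q: "Q n B" and D: "D \<in> Co W" for n B D
    proof -
      have B: "B \<in> Co W" "K B = K A" using Q by (auto simp: Q_def)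
      have BD: "B \<inter> D \<in> Co W" "B - D \<in> Co W" using B(1) D by auto
      have "PI B" using PI_if_class B A by simp
      then have "B \<inter> D \<asymp> B \<or> B - B \<inter> D \<asymp> B"
        using BD(1) unfolding pseudo_indecomposable_def by blast
      moreover have "B - B \<inter> D = B - D" by blast
      ultimately have "K (B \<inter> D) = K A \<or> K (B - D) = K A"
        using iso_class_eq_iff BD B by metis
      then show ?thesis
      proof
        assume "K (B \<inter> D) = K A"
        then show ?thesis using BD by (intro exI[of _ "B \<inter> D"]) (auto simp: Q_def)
      next
        assume "K (B - D) = K A"
        then show ?thesis using BD by (intro exI[of _ "B - D"]) (auto simp: Q_def)
      qed
    qed
  qed
  then obtain w H where H: "\<forall>n. Q n (H n) \<and> w \<in> H n \<and> H n \<subseteq> A"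
    and small: "\<forall>U. openin W U \<and> w \<in> U \<longrightarrow> (\<exists>n. H n \<subseteq> U)"
    by (elim exE conjE) (rule that)
  have "w \<in> A" using H by blast
  moreover have "w \<in> XC (K A)"
    unfolding XC_iff
  proof (intro conjI allI impI)
    show "w \<in> topspace W" using \<open>w \<in> A\<close> Co_subset_topspace[OF A(1)] by blast
    fix U assume "openin W U \<and> w \<in> U"
    then obtain n where "H n \<subseteq> U" using small by blast
    moreover have "H n \<in> Co W" "K (H n) = K A" "w \<in> H n" using H unfolding Q_def by blast+
    ultimately show "\<exists>B\<in>Co W. K B = K A \<and> w \<in> B \<and> B \<subseteq> U" by blast
  qed
  ultimately show ?thesis by blast
qed

lemma class_meets_iff:
  assumes A: "A \<in> Co W" "K A \<in> S" and q: "q \<in> S"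
  shows "A \<inter> XC q \<noteq> {} \<longleftrightarrow> K A \<unlhd>\<^sub>e q"
proof
  assume "A \<inter> XC q \<noteq> {}"
  then obtain w where "w \<in> A" "w \<in> XC q" by blast
  then obtain B where "B \<in> Co W" "K B = q" "B \<subseteq> A"
    using XC_nbhd[OF _ Co_openin[OF A(1)]] by blast
  then show "K A \<unlhd>\<^sub>e q" using subset_leq_e A q by blast
next
  assume "K A \<unlhd>\<^sub>e q"
  then obtain B where B: "B \<in> Co W" "B \<subseteq> A" "K B = q" using leq_e_subset A by blast
  then obtain w where "w \<in> B" "w \<in> XC q" using class_point[of B] q by blast
  then show "A \<inter> XC q \<noteq> {}" using B by blast
qed

lemma two_points_embed:
  assumes p: "p \<in> S" and A: "A \<in> Co W" "K A = p" and wx: "w \<in> A \<inter> XC p" "x \<in> A \<inter> XC p" "w \<noteq> x"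
  shows "embeds p p"
proof -
  have wt: "w \<in> topspace W" using wx(1) Co_subset_topspace[OF A(1)] by blast
  obtain C where C: "C \<in> Co W" "w \<in> C" "x \<notin> C"
    using Co_separate[OF wt wx(3)] by blast
  have AC: "A \<inter> C \<in> Co W" "A - C \<in> Co W" using A C by auto
  obtain B where B: "B \<in> Co W" "K B = p" "B \<subseteq> A \<inter> C"
    using XC_nbhd[of w p "A \<inter> C"] Co_openin[OF AC(1)] wx C by blast
  obtain D where D: "D \<in> Co W" "K D = p" "D \<subseteq> A - C"
    using XC_nbhd[of x p "A - C"] Co_openin[OF AC(2)] wx C by blast
  show ?thesis
    unfolding embeds_def using p A B D
    by (intro conjI bexI[of _ A] bexI[of _ B] bexI[of _ D]) auto
qed

lemma embedding_system_sel [simp]: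
  "po_carrier embedding_system = S" "po_less embedding_system = embeds"
  by (simp_all add: embedding_system_def)

lemma leq_e_antisym: "\<lbrakk>p \<unlhd>\<^sub>e q; q \<unlhd>\<^sub>e p\<rbrakk> \<Longrightarrow> p = q"
  unfolding leq_e_iff using embeds_antisym by blast

lemma class_Trim_e:
  assumes A: "A \<in> Co W" "K A \<in> S"
  shows "A \<in> Trim W embedding_system XC (K A)"
proof -
  have "type_set embedding_system XC A = po_up embedding_system (K A)"
    unfolding type_set_def po_up_def using class_meets_iff[OF A] by auto
  moreover have "card (A \<inter> XC (K A)) = 1" if irr: "\<not> embeds (K A) (K A)"
  proof -
    obtain w where w: "w \<in> A" "w \<in> XC (K A)" using class_point[OF A] by blast
    have "A \<inter> XC (K A) = {w}"
    proof (intro equalityI subsetI)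
      fix x assume x: "x \<in> A \<inter> XC (K A)"
      then show "x \<in> {w}" using two_points_embed[OF A(2,1) refl _ x, of w] w irr by blast
    qed (use w in blast)
    then show ?thesis by simp
  qed
  ultimately show ?thesis using A unfolding Trim_def po_irrefl_def by simp
qed

lemma XC_disjoint:
  assumes "p \<in> S" "q \<in> S" "w \<in> XC p" "w \<in> XC q"
  shows "p = q"
proof -
  have wt: "w \<in> topspace W" using assms XC_iff by blast
  obtain A where A: "A \<in> Co W" "K A = p" "w \<in> A" using XC_nbhd[OF assms(3) openin_topspace wt] by blast
  obtain B where B: "B \<in> Co W" "K B = q" "w \<in> B" using XC_nbhd[OF assms(4) openin_topspace wt] by blast
  have "A \<inter> XC q \<noteq> {}" "B \<inter> XC p \<noteq> {}" using assms A B by blast+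
  then have "p \<unlhd>\<^sub>e q" "q \<unlhd>\<^sub>e p"
    using class_meets_iff A B assms(1,2) by blast+
  then show ?thesis by (rule leq_e_antisym)
qed

lemma XC_limit_iff:
  assumes p: "p \<in> S" and q: "q \<in> S" and w: "w \<in> XC q"
  shows "w \<in> W derived_set_of XC p \<longleftrightarrow> embeds q p"
proof
  assume lim: "w \<in> W derived_set_of XC p"
  have wt: "w \<in> topspace W" using w XC_iff by blast
  obtain A where A: "A \<in> Co W" "K A = q" "w \<in> A" using XC_nbhd[OF w openin_topspace wt] by blast
  obtain x where x: "x \<noteq> w" "x \<in> XC p" "x \<in> A"
    using lim A Co_openin unfolding in_derived_set_of by blast
  then have "q \<unlhd>\<^sub>e p" using class_meets_iff[of A p] A p q by blast
  moreover have "embeds q q" if "q = p"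
    using two_points_embed[OF q A(1,2), of w x] A w x that by blast
  ultimately show "embeds q p" unfolding leq_e_iff by blast
next
  assume qp: "embeds q p"
  show "w \<in> W derived_set_of XC p"
    unfolding in_derived_set_of
  proof (intro conjI allI impI)
    show "w \<in> topspace W" using w XC_iff by blast
    fix U assume U: "w \<in> U \<and> openin W U"
    then obtain A where A: "A \<in> Co W" "K A = q" "w \<in> A" "A \<subseteq> U" using XC_nbhd[OF w] by blast
    obtain B C where BC: "B \<in> Co W" "C \<in> Co W" "B \<subseteq> A" "C \<subseteq> A" "B \<inter> C = {}" "K B = q" "K C = p"
      using embeds_in[OF qp A(1,2)] by blast
    obtain y where y: "y \<in> B" "y \<in> XC q" using class_point[OF BC(1)] BC(6) q by blast
    obtain z where z: "z \<in> C" "z \<in> XC p" using class_point[OF BC(2)] BC(7) p by blast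
    show "\<exists>x. x \<noteq> w \<and> x \<in> XC p \<and> x \<in> U"
    proof (cases "z = w")
      case True
      then have "p = q" using XC_disjoint p q z w by blast
      then have "y \<in> XC p" "y \<noteq> w" using y z True BC(5) by auto
      then show ?thesis using y BC A by blast
    next
      case False
      then show ?thesis using z BC A by blast
    qed
  qed
qed

lemma trim_partition_embedding: "trim_partition W embedding_system XC"
  unfolding trim_partition_def
proof (intro conjI)
  show "po_partition W embedding_system XC"
    unfolding po_partition_def
  proof (intro conjI ballI)
    show "po_system embedding_system"
      unfolding po_system_def embedding_system_sel
      by (intro conjI antisymp_onI transp_onI) (use embeds_antisym embeds_trans in blast)+
    fix p assume p: "p \<in> po_carrier embedding_system"
    then obtain A where A: "PI A" "p = K A" using S_iff by auto
    have "\<exists>w\<in>A. w \<in> XC (K A)" using class_point[OF PI_Co[OF A(1)]] p A by simp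
    then show "XC p \<noteq> {}" using A by blast
    show "XC p \<subseteq> topspace W" using XC_iff by blast
  next
    show "disjoint_family_on XC (po_carrier embedding_system)"
      unfolding disjoint_family_on_def embedding_system_sel using XC_disjoint by blast
    fix p assume p: "p \<in> po_carrier embedding_system"
    show "(W derived_set_of XC p) \<inter> family_union embedding_system XC =
        (\<Union>q\<in>{q \<in> po_carrier embedding_system. po_less embedding_system q p}. XC q)"
    proof (intro equalityI subsetI)
      fix w assume "w \<in> (W derived_set_of XC p) \<inter> family_union embedding_system XC"
      then show "w \<in> (\<Union>q\<in>{q \<in> po_carrier embedding_system. po_less embedding_system q p}. XC q)"
        using XC_limit_iff[of p _ w] p unfolding family_union_def by auto
    next
      fix w assume "w \<in> (\<Union>q\<in>{q \<in> po_carrier embedding_system. po_less embedding_system q p}. XC q)"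
      then show "w \<in> (W derived_set_of XC p) \<inter> family_union embedding_system XC"
        using XC_limit_iff[of p _ w] p unfolding family_union_def by auto
    qed
  qed
  show "T1_condition W embedding_system XC"
    unfolding T1_condition_def neighbourhood_base_at_def
  proof (intro ballI allI impI)
    fix w V assume "openin W V \<and> w \<in> V"
    then obtain A where A: "PI A" "w \<in> A" "A \<subseteq> V" using PI_base by blast
    have "K A \<in> S" using A S_iff by blast
    then have "trim_set W embedding_system XC A"
      unfolding trim_set_def using class_Trim_e[OF PI_Co[OF A(1)]] by auto
    then show "\<exists>U B. openin W U \<and> trim_set W embedding_system XC B \<and> w \<in> U \<and> U \<subseteq> B \<and> B \<subseteq> V"
      using A Co_openin[OF PI_Co[OF A(1)]] by (intro exI[of _ A]) simp
  qed
  show "T3_condition W embedding_system XC"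
    unfolding T3_condition_def embedding_system_sel
  proof (intro ballI)
    fix p w assume p: "p \<in> S" and w: "w \<in> XC p"
    have wt: "w \<in> topspace W" using w XC_iff by blast
    obtain A where "A \<in> Co W" "K A = p" "w \<in> A" using XC_nbhd[OF w openin_topspace wt] by blast
    then show "\<exists>A\<in>Trim W embedding_system XC p. w \<in> A" using class_Trim_e p by blast
  qed
  show "T2_condition W embedding_system XC"
    unfolding T2_condition_def
  proof (intro ballI impI)
    fix p w assume "p \<in> trim_types W embedding_system XC" and wt: "w \<in> topspace W"
      and base: "neighbourhood_base_at w (\<lambda>A. A \<in> Trim W embedding_system XC p) W"
    then have p: "p \<in> S" by (simp add: trim_types_def)
    have meets: "A \<inter> XC q \<noteq> {} \<longleftrightarrow> p \<unlhd>\<^sub>e q" if "A \<in> Trim W embedding_system XC p" "q \<in> S" for A q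
      using that by (auto simp: Trim_def type_set_def po_up_def)
    have small: "\<exists>A. A \<in> Trim W embedding_system XC p \<and> w \<in> A \<and> A \<subseteq> U" if "openin W U" "w \<in> U" for U
      using base that unfolding neighbourhood_base_at_def by (meson subsetD)
    show "w \<in> XC p"
      unfolding XC_iff
    proof (intro conjI allI impI)
      fix U assume U: "openin W U \<and> w \<in> U"
      then obtain A where A: "A \<in> Trim W embedding_system XC p" "w \<in> A" "A \<subseteq> U" using small by blast
      then have "openin W A" using Co_openin by (simp add: Trim_def)
      then obtain D where D: "PI D" "w \<in> D" "D \<subseteq> A" using PI_base A(2) by blast
      have DCo: "D \<in> Co W" using PI_Co D by blast
      have DS: "K D \<in> S" using D S_iff by blast
      obtain B where B: "B \<in> Trim W embedding_system XC p" "B \<subseteq> D"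
        using small[OF Co_openin[OF DCo] D(2)] by blast
      have "B \<inter> XC p \<noteq> {}" using meets[OF B(1) p] by (simp add: leq_e_iff)
      then have "D \<inter> XC p \<noteq> {}" using B(2) by blast
      then have "K D \<unlhd>\<^sub>e p" using class_meets_iff[OF DCo DS p] by blast
      moreover have "D \<inter> XC (K D) \<noteq> {}" using class_point[OF DCo DS] by blast
      then have "A \<inter> XC (K D) \<noteq> {}" using D(3) by blast
      then have "p \<unlhd>\<^sub>e K D" using meets[OF A(1) DS] by blast
      ultimately have "K D = p" by (rule leq_e_antisym)
      then show "\<exists>A\<in>Co W. K A = p \<and> w \<in> A \<and> A \<subseteq> U" using DCo D A by blast
    qed (rule wt)
  qed
qed

text \<open>
  The order on the classes is left open, because the lemma serves both to identify the order of
  \<open>\<S>(W)\<close> with \<open>embeds\<close> and, once this is done, to describe the trim sets for \<open>\<S>(W)\<close> itself.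
\<close>

lemma Trim_imp_iso:
  assumes trim: "trim_partition W P XC" and P: "po_carrier P = S"
    and A: "A \<in> Trim W P XC p" and B: "B \<in> Trim W P XC p" and p: "p \<in> S"
  shows "A \<asymp> B"
proof -
  interpret t: trim_part W P XC by unfold_locales (rule trim)
  have pC: "p \<in> po_carrier P" using p P by simp
  obtain w x where w: "w \<in> A" "w \<in> XC p" and x: "x \<in> B" "x \<in> XC p"
    using t.Trim_meets[OF A pC] t.Trim_meets[OF B pC] by blast
  have "point_types W P XC w = point_types W P XC x"
    using t.types_of_X[OF pC w(2)] t.types_of_X[OF pC x(2)] by simp
  from t.Trim_homeomorphic[OF pC A B w(1) x(1) this]
  obtain h where "homeomorphic_map (subtopology W A) (subtopology W B) h" by blast
  then show ?thesis using homeomorphic_imp_iso t.Trim_Co[OF A] t.Trim_Co[OF B] by blast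
qed

text \<open>
  The crucial case is \<open>p = q\<close>.  There a copy \<open>E\<close> of \<open>A\<close> is removed from \<open>A\<close>, and because of a second,
  disjoint copy the rest still contains a point of type \<open>p\<close>.  So the rest is \<open>p\<close>-trim, and hence
  isomorphic to \<open>A\<close>.
\<close>

lemma PI_less_iff_embeds: "po_less (PI_system W) p q \<longleftrightarrow> embeds p q"
proof
  assume less: "po_less (PI_system W) p q"
  then obtain A B where A: "PI A" "p = K A" and B: "PI B" "q = K B"
    unfolding PI_system_def by auto
  have ACo: "A \<in> Co W" using PI_Co A by blast
  obtain D where D: "D \<in> Co W" "D \<subseteq> A" "K D = K A" "K (A - D) = K B"
    using PI_less_iff[OF A(1) B(1)] less A B by blast
  have "K A \<in> S" "K B \<in> S" using A B S_iff by blast+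
  then show "embeds p q"
    unfolding embeds_def using A B D ACo
    by (intro conjI bexI[of _ A] bexI[of _ D] bexI[of _ "A - D"]) auto
next
  assume emb: "embeds p q"
  then obtain A B where A: "PI A" "p = K A" and B: "PI B" "q = K B"
    unfolding embeds_def S_iff by blast
  have ACo: "A \<in> Co W" and BCo: "B \<in> Co W" using PI_Co A B by blast+
  obtain D E where DE: "D \<in> Co W" "E \<in> Co W" "D \<subseteq> A" "E \<subseteq> A" "D \<inter> E = {}" "K D = p" "K E = q"
    using embeds_in[OF emb ACo] A(2) by blast
  have pS: "p \<in> S" using emb unfolding embeds_def by blast
  have AECo: "A - E \<in> Co W" using ACo DE by blast
  have "K (A - E) = p"
  proof (cases "p = q")
    case False
    then have "\<not> E \<asymp> A" using iso_class_eq_iff DE(2,7) ACo A(2) by metis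
    then have "A - E \<asymp> A" using A(1) DE(2,4) unfolding pseudo_indecomposable_def by blast
    then show ?thesis using iso_class_eq_iff AECo ACo A(2) by blast
  next
    case True
    interpret t: trim_part W embedding_system XC by unfold_locales (rule trim_partition_embedding)
    have trim_A: "A \<in> Trim W embedding_system XC p" using class_Trim_e[OF ACo] A pS by simp
    have "D \<inter> XC p \<noteq> {}" using class_point[OF DE(1)] DE(6) pS by blast
    then have "(A - E) \<inter> XC p \<noteq> {}" using DE(3,5) by blast
    then have "A - E \<in> Trim W embedding_system XC p"
      using t.Trim_subset[OF trim_A _ AECo] pS by auto
    then have "A - E \<asymp> A"
      using Trim_imp_iso[OF trim_partition_embedding _ _ trim_A] pS by simp
    then show ?thesis using iso_class_eq_iff AECo ACo A(2) by blast
  qed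
  moreover have "A - (A - E) = E" using DE(4) by blast
  ultimately have "\<exists>D\<in>Co W. D \<subseteq> A \<and> K D = K A \<and> K (A - D) = K B"
    using AECo DE(7) A(2) B(2) by (intro bexI[of _ "A - E"]) auto
  then show "po_less (PI_system W) p q" using PI_less_iff[OF A(1) B(1)] A(2) B(2) by blast
qed

lemma PI_system_eq: "PI_system W = embedding_system"
  by (rule po_sys.equality) (simp_all add: fun_eq_iff PI_less_iff_embeds)

theorem canonical_trim_partition: "trim_partition W (PI_system W) XC"
  unfolding PI_system_eq by (rule trim_partition_embedding)

section \<open>The orbit diagram\<close>

sublocale canonical: trim_part W "PI_system W" XC
  by unfold_locales (rule canonical_trim_partition)

lemma class_Trim_iff:
  assumes p: "p \<in> S"
  shows "A \<in> Trim W (PI_system W) XC p \<longleftrightarrow> A \<in> Co W \<and> K A = p"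
proof -
  have classD: "B \<in> Trim W (PI_system W) XC p" if B: "B \<in> Co W" "K B = p" for B
  proof -
    have "B \<in> Trim W embedding_system XC (K B)"
      by (rule class_Trim_e) (use B p in simp_all)
    then show ?thesis unfolding PI_system_eq B(2) .
  qed
  obtain B where B: "PI B" "p = K B" using p S_iff by blast
  have "K A = p" if A: "A \<in> Trim W (PI_system W) XC p"
  proof -
    have "A \<asymp> B"
      using Trim_imp_iso[OF canonical_trim_partition refl A classD p] PI_Co B by blast
    then show ?thesis
      using iso_class_eq_iff canonical.Trim_Co[OF A] PI_Co[OF B(1)] B(2) by blast
  qed
  then show ?thesis using classD canonical.Trim_Co by blast
qed

text \<open>
  The trim sets of type \<open>p\<close> are the compact open sets of class \<open>p\<close>, a property that
  homeomorphisms preserve.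
\<close>

lemma homeomorphism_types:
  assumes g: "homeomorphic_map W W g"
  shows "canonical.I w \<subseteq> canonical.I (g w)"
proof
  fix p assume "p \<in> canonical.I w"
  then obtain A where A: "p \<in> S" "A \<in> Trim W (PI_system W) XC p" "w \<in> A"
    unfolding canonical.types_iff by blast
  then have "A \<in> Co W" "K A = p" using class_Trim_iff by blast+
  then have "g ` A \<in> Trim W (PI_system W) XC p"
    using class_Trim_iff[OF A(1)] homeomorphism_iso_class[OF g] by metis
  then show "p \<in> canonical.I (g w)" unfolding canonical.types_iff using A by blast
qed

lemma orbit_eq:
  assumes w: "w \<in> topspace W"
  shows "point_orbit W w = canonical.XI (canonical.I w)"
proof (intro equalityI subsetI)
  fix x assume "x \<in> point_orbit W w"
  then obtain g where g: "homeomorphic_map W W g" "x = g w" unfolding point_orbit_def by blast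
  obtain k where gk: "homeomorphic_maps W W g k" using g homeomorphic_map_maps by blast
  then have "homeomorphic_maps W W k g" using homeomorphic_maps_sym by blast
  then have k: "homeomorphic_map W W k" by (rule homeomorphic_maps_imp_map)
  have "k (g w) = w" using gk w unfolding homeomorphic_maps_def by blast
  then have "canonical.I w = canonical.I x"
    using homeomorphism_types[OF g(1), of w] homeomorphism_types[OF k, of x] g(2) by auto
  moreover have "x \<in> topspace W"
    using g w homeomorphic_imp_surjective_map[OF g(1)] by blast
  ultimately show "x \<in> canonical.XI (canonical.I w)" by (simp add: canonical.XI_iff)
next
  fix x assume "x \<in> canonical.XI (canonical.I w)"
  then have "x \<in> topspace W" "canonical.I w = canonical.I x" by (auto simp: canonical.XI_iff)
  then show "x \<in> point_orbit W w"
    using canonical.same_types_same_orbit[OF w] unfolding point_orbit_def by blast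
qed

theorem orbit_diagram_iso: "po_iso canonical.XI canonical.IP (orbit_diagram W)"
  unfolding po_iso_def
proof (intro conjI ballI)
  have "canonical.XI ` {J. po_ideal (PI_system W) J} = point_orbit W ` topspace W"
  proof (intro equalityI subsetI)
    fix Z assume "Z \<in> canonical.XI ` {J. po_ideal (PI_system W) J}"
    then obtain J where J: "po_ideal (PI_system W) J" "Z = canonical.XI J" by blast
    obtain w where "w \<in> canonical.XI J" using canonical.XI_nonempty[OF J(1)] by blast
    then have "w \<in> topspace W" "canonical.I w = J" by (auto simp: canonical.XI_iff)
    then show "Z \<in> point_orbit W ` topspace W" using orbit_eq J(2) by blast
  next
    fix Z assume "Z \<in> point_orbit W ` topspace W"
    then obtain w where w: "w \<in> topspace W" "Z = point_orbit W w" by blast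
    then have "Z = canonical.XI (canonical.I w)" using orbit_eq by simp
    then show "Z \<in> canonical.XI ` {J. po_ideal (PI_system W) J}"
      using canonical.types_ideal[OF w(1)] by blast
  qed
  moreover have "inj_on canonical.XI {J. po_ideal (PI_system W) J}"
  proof (rule inj_onI)
    fix J J' assume J: "J \<in> {J. po_ideal (PI_system W) J}" and eq: "canonical.XI J = canonical.XI J'"
    obtain w where w: "w \<in> canonical.XI J" using canonical.XI_nonempty J by blast
    then have "w \<in> canonical.XI J'" using eq by simp
    with w show "J = J'" by (auto simp: canonical.XI_iff)
  qed
  ultimately show "bij_betw canonical.XI (po_carrier canonical.IP) (po_carrier (orbit_diagram W))"
    by (simp add: bij_betw_def id_completion_def orbit_diagram_def)
next
  fix J J' assume "J \<in> po_carrier canonical.IP" "J' \<in> po_carrier canonical.IP"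
  then have J: "po_ideal (PI_system W) J" "po_ideal (PI_system W) J'"
    by (auto simp: canonical.id_carrier)
  obtain w where "w \<in> canonical.XI J" using canonical.XI_nonempty[OF J(1)] by blast
  then show "po_less canonical.IP J J' \<longleftrightarrow> po_less (orbit_diagram W) (canonical.XI J) (canonical.XI J')"
    using canonical.XI_limit_iff[OF J] unfolding orbit_diagram_def by auto
qed

end

section \<open>Reindexing a partition\<close>

lemma po_iso_type_set:
  assumes f: "po_iso f P Q" and Y: "\<And>p. p \<in> po_carrier P \<Longrightarrow> Y (f p) = X p"
  shows "type_set Q Y A = f ` type_set P X A"
proof -
  have im: "po_carrier Q = f ` po_carrier P" using f unfolding po_iso_def bij_betw_def by blast
  have "type_set Q Y A = f ` {p \<in> po_carrier P. A \<inter> Y (f p) \<noteq> {}}"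
    unfolding type_set_def im by (rule Collect_conj_eq[THEN trans]) blast
  also have "{p \<in> po_carrier P. A \<inter> Y (f p) \<noteq> {}} = type_set P X A"
    unfolding type_set_def by (rule Collect_cong) (simp add: Y cong: conj_cong)
  finally show ?thesis .
qed

lemma po_iso_po_up:
  assumes f: "po_iso f P Q" and p: "p \<in> po_carrier P"
  shows "po_up Q (f p) = f ` po_up P p"
proof -
  have im: "po_carrier Q = f ` po_carrier P" and inj: "inj_on f (po_carrier P)"
    and less: "\<And>q. q \<in> po_carrier P \<Longrightarrow> po_less Q (f p) (f q) \<longleftrightarrow> po_less P p q"
    using f p unfolding po_iso_def bij_betw_def by blast+
  have "po_leq Q (f p) (f q) \<longleftrightarrow> po_leq P p q" if "q \<in> po_carrier P" for q
    unfolding po_leq_def using less[OF that] inj_on_eq_iff[OF inj p that] by blast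
  then show ?thesis unfolding po_up_def im by auto
qed

lemma po_partition_reindex:
  assumes f: "po_iso f P Q" and Y: "\<And>p. p \<in> po_carrier P \<Longrightarrow> Y (f p) = X p"
    and part: "po_partition W P X"
  shows "po_partition W Q Y"
proof -
  have im: "po_carrier Q = f ` po_carrier P" and inj: "inj_on f (po_carrier P)"
    and less: "\<And>p q. \<lbrakk>p \<in> po_carrier P; q \<in> po_carrier P\<rbrakk> \<Longrightarrow> po_less Q (f p) (f q) \<longleftrightarrow> po_less P p q"
    using f unfolding po_iso_def bij_betw_def by blast+
  have sys: "antisymp_on (po_carrier P) (po_less P)" "transp_on (po_carrier P) (po_less P)"
    using part unfolding po_partition_def po_system_def by blast+
  have union: "family_union Q Y = family_union P X"
    unfolding family_union_def im using Y by auto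
  show ?thesis
    unfolding po_partition_def
  proof (intro conjI ballI)
    show "po_system Q"
      unfolding po_system_def im
    proof (intro conjI antisymp_onI transp_onI)
      fix x y assume "x \<in> f ` po_carrier P" "y \<in> f ` po_carrier P" "po_less Q x y" "po_less Q y x"
      then obtain p q where "x = f p" "y = f q" "p \<in> po_carrier P" "q \<in> po_carrier P"
          "po_less P p q" "po_less P q p"
        using less by blast
      then show "x = y" using antisymp_onD[OF sys(1)] by blast
    next
      fix x y z
      assume "x \<in> f ` po_carrier P" "y \<in> f ` po_carrier P" "z \<in> f ` po_carrier P"
        and "po_less Q x y" "po_less Q y z"
      then obtain p q r where "x = f p" "z = f r" "p \<in> po_carrier P" "q \<in> po_carrier P"
          "r \<in> po_carrier P" "po_less P p q" "po_less P q r"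
        using less by blast
      then show "po_less Q x z" using less transp_onD[OF sys(2)] by blast
    qed
    show "Y q \<noteq> {}" "Y q \<subseteq> topspace W" if "q \<in> po_carrier Q" for q
      using that Y part unfolding im po_partition_def by auto
    show "disjoint_family_on Y (po_carrier Q)"
      unfolding disjoint_family_on_def im
    proof (intro ballI impI)
      fix m n assume "m \<in> f ` po_carrier P" "n \<in> f ` po_carrier P" "m \<noteq> n"
      then obtain p q where "p \<in> po_carrier P" "q \<in> po_carrier P" "m = f p" "n = f q" "p \<noteq> q" by blast
      then show "Y m \<inter> Y n = {}" using Y part unfolding po_partition_def disjoint_family_on_def by simp
    qed
    fix q assume "q \<in> po_carrier Q"
    then obtain p where p: "p \<in> po_carrier P" "q = f p" unfolding im by blast
    have "(W derived_set_of Y q) \<inter> family_union Q Y = (\<Union>r\<in>{r \<in> po_carrier P. po_less P r p}. X r)"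
      unfolding union p(2) Y[OF p(1)] using part p(1) unfolding po_partition_def by blast
    also have "\<dots> = (\<Union>r\<in>{r \<in> po_carrier Q. po_less Q r q}. Y r)"
      unfolding im p(2) using less[OF _ p(1)] Y by auto
    finally show "(W derived_set_of Y q) \<inter> family_union Q Y = (\<Union>r\<in>{r \<in> po_carrier Q. po_less Q r q}. Y r)" .
  qed
qed

lemma T1_reindex:
  assumes f: "po_iso f P Q" and Y: "\<And>p. p \<in> po_carrier P \<Longrightarrow> Y (f p) = X p"
    and T1: "T1_condition W P X"
  shows "T1_condition W Q Y"
proof -
  have "trim_set W Q Y A" if "trim_set W P X A" for A
  proof -
    obtain p where p: "p \<in> po_carrier P" "A \<in> Trim W P X p" using \<open>trim_set W P X A\<close> unfolding trim_set_def by blast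
    have fp: "f p \<in> po_carrier Q" and refl: "po_less Q (f p) (f p) \<longleftrightarrow> po_less P p p"
      using f p(1) unfolding po_iso_def bij_betw_def by blast+
    have "type_set Q Y A = po_up Q (f p)"
      using po_iso_type_set[of f P Q Y X A, OF f Y] po_iso_po_up[OF f p(1)] p(2)
      by (simp add: Trim_def)
    then have "A \<in> Trim W Q Y (f p)"
      using p fp refl Y[OF p(1)] unfolding Trim_def po_irrefl_def by simp
    then show ?thesis using fp unfolding trim_set_def by blast
  qed
  then show ?thesis
    using T1 neighbourhood_base_at_mono unfolding T1_condition_def by metis
qed

section \<open>Regular consolidation\<close>

theorem corollary4p23:
  fixes W :: "'w topology"
  assumes "omega_stone_space W" and "primitive_space W"
  shows "po_iso (id_part W (PI_system W) (canonical_partition W))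
           (id_completion (PI_system W)) (orbit_diagram W) \<and>
         (\<forall>(Q :: 'q po_sys) (Y :: 'q \<Rightarrow> 'w set).
            trim_partition W Q Y \<longrightarrow>
            regularly_consolidates W (orbit_diagram W) (\<lambda>p. p)
              (id_completion Q) (id_part W Q Y))"
proof (intro conjI allI impI)
  interpret primitive_omega W by unfold_locales (fact assms)+
  show iso: "po_iso (id_part W (PI_system W) (canonical_partition W))
           (id_completion (PI_system W)) (orbit_diagram W)"
    by (rule orbit_diagram_iso)
  fix Q :: "'q po_sys" and Y :: "'q \<Rightarrow> 'w set"
  assume "trim_partition W Q Y"
  then interpret t: trim_part W Q Y by unfold_locales
  \<comment> \<open>All points with the same ideal lie in one orbit, so the choice of the point is immaterial.\<close>
  define \<alpha> where "\<alpha> = (\<lambda>J. point_orbit W (SOME w. w \<in> t.XI J))"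
  have \<alpha>: "\<alpha> (t.I w) = point_orbit W w" if w: "w \<in> topspace W" for w
  proof -
    define x where "x = (SOME x. x \<in> t.XI (t.I w))"
    have "x \<in> t.XI (t.I w)"
      unfolding x_def by (rule someI[of _ w]) (simp add: t.XI_iff w)
    then have x: "x \<in> topspace W" "t.I x = t.I w" by (auto simp: t.XI_iff)
    then have "x \<in> point_orbit W w"
      using t.same_types_same_orbit[OF w x(1)] unfolding point_orbit_def by auto
    then have "point_orbit W x = point_orbit W w"
      using orbit_eq[OF w] orbit_eq[OF x(1)] by (auto simp: canonical.XI_iff)
    then show ?thesis by (simp add: \<alpha>_def x_def)
  qed
  have self: "w \<in> point_orbit W w" if "w \<in> topspace W" for w
    using orbit_eq[OF that] that by (simp add: canonical.XI_iff)
  show "regularly_consolidates W (orbit_diagram W) (\<lambda>p. p) (id_completion Q) (id_part W Q Y)"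
    unfolding regularly_consolidates_def
  proof (intro conjI exI[of _ \<alpha>] ballI)
    show "po_partition W (orbit_diagram W) (\<lambda>p. p)"
      by (rule po_partition_reindex[OF iso _ canonical.id_partition]) simp
    show "T1_condition W (orbit_diagram W) (\<lambda>p. p)"
      by (rule T1_reindex[OF iso _ canonical.id_T1]) simp
    show "po_partition W (id_completion Q) (id_part W Q Y)" by (rule t.id_partition)
    show "T1_condition W (id_completion Q) (id_part W Q Y)" by (rule t.id_T1)
    have point: "\<exists>w. w \<in> topspace W \<and> t.I w = J" if "J \<in> po_carrier t.IP" for J
      using t.XI_nonempty that unfolding t.id_carrier t.XI_iff[symmetric] by blast
    show "\<alpha> \<in> po_carrier t.IP \<rightarrow> po_carrier (orbit_diagram W)"
      using point \<alpha> by (fastforce simp: orbit_diagram_def)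
    show "t.XI J \<subseteq> \<alpha> J" if "J \<in> po_carrier t.IP" for J
      using \<alpha> self by (auto simp: t.XI_iff)
    fix p A assume p: "p \<in> trim_types W (orbit_diagram W) (\<lambda>p. p)"
      and A: "A \<in> Trim W (orbit_diagram W) (\<lambda>p. p) p"
    have pO: "p \<in> point_orbit W ` topspace W" using p by (simp add: trim_types_def orbit_diagram_def)
    have "p \<in> po_up (orbit_diagram W) p"
      using p by (simp add: trim_types_def po_up_def po_leq_def)
    then have "A \<inter> p \<noteq> {}" using A by (auto simp: Trim_def type_set_def)
    then obtain w where w: "w \<in> A" "w \<in> p" by blast
    have "A \<in> Co W" using A by (simp add: Trim_def)
    then have wt: "w \<in> topspace W" using Co_subset_topspace w by blast
    have "p = point_orbit W w"
    proof -
      obtain x where x: "x \<in> topspace W" "p = point_orbit W x" using pO by blast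
      then show ?thesis using orbit_eq[OF x(1)] orbit_eq[OF wt] w(2) by (auto simp: canonical.XI_iff)
    qed
    then have "p = \<alpha> (t.I w)" using \<alpha>[OF wt] by simp
    moreover have "t.I w \<in> type_set t.IP t.XI A"
      using w wt t.types_ideal[OF wt] unfolding type_set_def t.id_carrier by (auto simp: t.XI_iff)
    ultimately show "p \<in> \<alpha> ` type_set (id_completion Q) (id_part W Q Y) A" by blast
  qed
qed

end
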